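(* Let $\mu,p,k$ be positive integers and let $f_0,\ldots,f_{p-1}$ be a $p$-periodic system of parameter-dependent maps $f_i:I_i\times\Theta\to I_{i+1\,(\mathrm{mod}\,p)}$, with cyclic compositions $F_0,\ldots,F_{p-1}$, as in the context. Let $\Lambda_0\in\Theta$ and let $a_0\in I_0$, $a_{m+1}=f_m(a_m,\Lambda_0)$ for $0\le m\le p-2$, be points of a $k\times p$-periodic orbit of the system at which the $A_\mu$ bifurcation conditions hold, i.e. for every $0\le m\le p-1$, $$F_m^k(a_m,\Lambda_0)=a_m,\qquad \partial_xF_m^k(a_m,\Lambda_0)=1,\qquad \partial_{x^i}F_m^k(a_m,\Lambda_0)=0\ \ (2\le i\le\mu),\qquad \partial_{x^{\mu+1}}F_m^k(a_m,\Lambda_0)\neq0.$$ If one of the transversality conditions of the $A_\mu$ bifurcation at $\Lambda=\Lambda_0$ is satisfied, say $$J_\Lambda\mathcal{F}_j^k(a_j,\Lambda_0)\neq 0$$ for some $j\in\{0,\ldots,p-1\}$, then it is satisfied for all the cyclic compositions of the individual maps, i.e. $$J_\Lambda\mathcal{F}_m^k(a_m,\Lambda_0)\neq 0\qquad\text{for every }0\le m\le p-1.$$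
   Context: The fibers $I_0,\ldots,I_{p-1}$ are real intervals and $\Theta\subset\mathbb{R}^\mu$ is the parameter set, with parameter $\Lambda=(\lambda_1,\ldots,\lambda_\mu)$. The maps $f_i(x,\Lambda)$, where $x$ is the real dynamic variable, satisfy $f_i(I_i,\Lambda)\subseteq I_{i+1\,(\mathrm{mod}\,p)}$ for all $\Lambda\in\Theta$, and $f_i\in\mathcal{C}^{\mu+1}(I_i)$ (in the dynamic variable) and $f_i\in\mathcal{C}^1(\Theta)$ (in the parameter). The system is $p$-periodic: it is the iteration $x_{n+1}=f_{n\,(\mathrm{mod}\,p)}(x_n,\Lambda)$, with $p$ the minimal period of the sequence of maps. All compositions are in the dynamic variable only: $(g\circ f)(x,\Lambda)=g(f(x,\Lambda),\Lambda)$. The cyclic compositions are $F_0=f_{p-1}\circ\cdots\circ f_0$ and $F_m=f_{m-1}\circ\cdots\circ f_0\circ f_{p-1}\circ\cdots\circ f_m$ for $1\le m\le p-1$, and $F_m^k$ is the $k$-fold composition of $F_m$ with itself. The points of a $k\times p$-periodic orbit of the system are the $k$-periodic points of the compositions $F_m$. For $H(x,\Lambda)=F_m^k(x,\Lambda)$ let $\mathcal{F}_m^k=(H,H_x,H_{xx},\ldots,H_{x^{\mu-1}})$, and let $$J_\Lambda\mathcal{F}_m^k(x,\Lambda)=\det\left[H_{x^{s-1}\lambda_r}(x,\Lambda)\right]_{s,r=1}^{\mu}$$ be its Jacobian determinant with respect to $\Lambda$, whose row $s$ ($1\le s\le\mu$) is $(H_{x^{s-1}\lambda_1},\ldots,H_{x^{s-1}\lambda_\mu})$.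 Subscripts denote partial derivatives, and $\partial_{x^i}$ denotes the $i$-th partial derivative with respect to $x$.
   Formalization: The x-derivatives of each f_i of order below μ are assumed C^1 jointly in (x,Λ), since with separate regularity in x and in Λ the claim fails; Θ is taken open and the intervals I_i nondegenerate, so that the derivatives make sense. *)

theory Defs
  imports "HOL-Analysis.Analysis"
begin

text \<open>Derivatives in the dynamic variable are taken within the fiber, so they are one-sided at an
  endpoint that belongs to the interval. They are only meant for nondegenerate intervals.\<close>

primrec nth_deriv :: "real set \<Rightarrow> nat \<Rightarrow> (real \<Rightarrow> real) \<Rightarrow> real \<Rightarrow> real" where
  "nth_deriv S 0 g = g"
| "nth_deriv S (Suc n) g = (\<lambda>x. vector_derivative (nth_deriv S n g) (at x within S))"

definition C_on :: "nat \<Rightarrow> real set \<Rightarrow> (real \<Rightarrow> real) \<Rightarrow> bool" where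
  "C_on n S g \<longleftrightarrow>
     (\<forall>i<n. \<forall>x\<in>S. nth_deriv S i g differentiable (at x within S)) \<and>
     (\<forall>i\<le>n. continuous_on S (nth_deriv S i g))"

definition dx :: "real set \<Rightarrow> nat \<Rightarrow> (real \<Rightarrow> 'p \<Rightarrow> real) \<Rightarrow> real \<Rightarrow> 'p \<Rightarrow> real" where
  "dx S i h x \<Lambda> = nth_deriv S i (\<lambda>y. h y \<Lambda>) x"

definition dparam :: "'n::finite \<Rightarrow> (real \<Rightarrow> real ^ 'n \<Rightarrow> real) \<Rightarrow> real \<Rightarrow> real ^ 'n \<Rightarrow> real" where
  "dparam r h x \<Lambda> = deriv (\<lambda>t. h x (\<Lambda> + t *\<^sub>R axis r 1)) 0"

definition C1_joint :: "real set \<Rightarrow> (real ^ 'n::finite) set \<Rightarrow> (real \<Rightarrow> real ^ 'n \<Rightarrow> real) \<Rightarrow> bool" where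
  "C1_joint S \<Theta> h \<longleftrightarrow>
     (\<forall>x\<in>S. \<forall>\<Lambda>\<in>\<Theta>. (\<lambda>y. h y \<Lambda>) differentiable (at x within S)) \<and>
     (\<forall>r. \<forall>x\<in>S. \<forall>\<Lambda>\<in>\<Theta>. (\<lambda>t. h x (\<Lambda> + t *\<^sub>R axis r 1)) field_differentiable (at 0)) \<and>
     continuous_on (S \<times> \<Theta>) (\<lambda>(x, \<Lambda>). dx S 1 h x \<Lambda>) \<and>
     (\<forall>r. continuous_on (S \<times> \<Theta>) (\<lambda>(x, \<Lambda>). dparam r h x \<Lambda>))"

text \<open>The maps are \<open>C\<^sup>\<mu>\<^sup>+\<^sup>1\<close> in the dynamic variable and \<open>C\<^sup>1\<close> in the parameter. The latter is
  understood jointly, for exactly those \<open>x\<close>-derivatives (orders below \<open>\<mu>\<close>) whose parameter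
  derivatives enter the Jacobian determinant. Separate regularity would not suffice: the
  compositions then need not have the derivatives occurring in that determinant.\<close>

definition regular_family ::
    "nat \<Rightarrow> real set \<Rightarrow> (real ^ 'n::finite) set \<Rightarrow> (real \<Rightarrow> real ^ 'n \<Rightarrow> real) \<Rightarrow> bool" where
  "regular_family \<mu> S \<Theta> h \<longleftrightarrow>
     (\<forall>\<Lambda>\<in>\<Theta>. C_on (\<mu> + 1) S (\<lambda>x. h x \<Lambda>)) \<and>
     (\<forall>i<\<mu>. C1_joint S \<Theta> (dx S i h))"

text \<open>The last conjunct says that \<open>p\<close> is the minimal period of the sequence of maps. Maps are
  compared as maps on their domains, that is, on \<open>I i \<times> \<Theta>\<close>.\<close>

definition periodic_system ::
    "nat \<Rightarrow> (nat \<Rightarrow> real set) \<Rightarrow> 'p set \<Rightarrow> (nat \<Rightarrow> real \<Rightarrow> 'p \<Rightarrow> real) \<Rightarrow> bool" where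
  "periodic_system p I \<Theta> f \<longleftrightarrow>
     0 < p \<and>
     (\<forall>i<p. \<forall>x\<in>I i. \<forall>\<Lambda>\<in>\<Theta>. f i x \<Lambda> \<in> I ((i + 1) mod p)) \<and>
     (\<forall>q. 0 < q \<and> q < p \<longrightarrow>
        \<not> (\<forall>n. I ((n + q) mod p) = I (n mod p) \<and>
              (\<forall>x\<in>I (n mod p). \<forall>\<Lambda>\<in>\<Theta>. f ((n + q) mod p) x \<Lambda> = f (n mod p) x \<Lambda>)))"

text \<open>The cyclic composition \<open>F\<^sub>m\<close> applies \<open>f\<^sub>m, \<dots>, f\<^sub>p\<^sub>-\<^sub>1, f\<^sub>0, \<dots>, f\<^sub>m\<^sub>-\<^sub>1\<close> in this order.\<close>

definition cyclic_comp ::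
    "(nat \<Rightarrow> real \<Rightarrow> 'p \<Rightarrow> real) \<Rightarrow> nat \<Rightarrow> nat \<Rightarrow> real \<Rightarrow> 'p \<Rightarrow> real" where
  "cyclic_comp f p m x \<Lambda> = fold (\<lambda>i y. f i y \<Lambda>) ([m..<p] @ [0..<m]) x"

definition iter_x :: "nat \<Rightarrow> (real \<Rightarrow> 'p \<Rightarrow> real) \<Rightarrow> real \<Rightarrow> 'p \<Rightarrow> real" where
  "iter_x k F x \<Lambda> = ((\<lambda>y. F y \<Lambda>) ^^ k) x"

definition A_conditions ::
    "nat \<Rightarrow> real set \<Rightarrow> (real \<Rightarrow> 'p \<Rightarrow> real) \<Rightarrow> real \<Rightarrow> 'p \<Rightarrow> bool" where
  "A_conditions \<mu> S H a \<Lambda> \<longleftrightarrow>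
     H a \<Lambda> = a \<and> dx S 1 H a \<Lambda> = 1 \<and>
     (\<forall>i. 2 \<le> i \<and> i \<le> \<mu> \<longrightarrow> dx S i H a \<Lambda> = 0) \<and>
     dx S (\<mu> + 1) H a \<Lambda> \<noteq> 0"

text \<open>The index type \<open>'n\<close> has no order of its own. The map \<open>num\<close> numbers it by \<open>1, \<dots>, \<mu>\<close>, so
  \<open>\<Lambda> $ r\<close> is \<open>\<lambda>\<^sub>s\<close> with \<open>s = num r\<close>, and row \<open>s\<close> holds the parameter derivatives of the
  \<open>x\<close>-derivative of order \<open>s - 1\<close>.\<close>

definition param_jacobian ::
    "('n::finite \<Rightarrow> nat) \<Rightarrow> real set \<Rightarrow> (real \<Rightarrow> real ^ 'n \<Rightarrow> real) \<Rightarrow> real \<Rightarrow> real ^ 'n \<Rightarrow> real" where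
  "param_jacobian num S H x \<Lambda> = det (\<chi> s r. dparam r (dx S (num s - 1) H) x \<Lambda>)"

end

theory Submission
  imports Defs "HOL-Library.Landau_Symbols"
begin

text \<open>Write \<open>G = F\<^sub>m\<^sup>k\<close>, \<open>H = F\<^sub>m\<^sub>+\<^sub>1\<^sup>k\<close>, \<open>f = f\<^sub>m\<close>, \<open>a = a\<^sub>m\<close>, \<open>b = a\<^sub>m\<^sub>+\<^sub>1 = f(a)\<close> and
  \<open>\<mu> = n + 1\<close>. The map \<open>f\<close> semiconjugates \<open>G\<close> to \<open>H\<close>, that is
  \<open>f(G(x,\<Lambda>),\<Lambda>) = H(f(x,\<Lambda>),\<Lambda>)\<close>. Differentiating this identity in a parameter gives, at \<open>\<Lambda>\<^sub>0\<close>,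
  \<open>f\<^sub>x(G(x)) G\<^sub>\<lambda>(x) + f\<^sub>\<lambda>(G(x)) = H\<^sub>x(f(x)) f\<^sub>\<lambda>(x) + H\<^sub>\<lambda>(f(x))\<close>.
  The degeneracy conditions say that \<open>G(x) = x\<close> and \<open>H\<^sub>x(f(x)) = 1\<close> up to errors \<open>o((x - a)\<^sup>n)\<close>. Since
  \<open>f\<^sub>x\<close> and \<open>f\<^sub>\<lambda>\<close> are \<open>n\<close> times continuously differentiable in \<open>x\<close>, replacing \<open>G(x)\<close> by \<open>x\<close> in them
  costs only such an error, the two terms \<open>f\<^sub>\<lambda>(x)\<close> cancel, and
  \<open>f\<^sub>x(x) G\<^sub>\<lambda>(x) - H\<^sub>\<lambda>(f(x)) = o((x - a)\<^sup>n)\<close>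
  remains (\<open>semiconj_param_derivative\<close>).

  The Jacobian of \<open>G\<close> at \<open>a\<close> vanishes iff some nonzero linear combination over the parameters of the
  functions \<open>G\<^sub>\<lambda>\<close> has vanishing \<open>x\<close>-derivatives of all orders up to \<open>n\<close> at \<open>a\<close>
  (\<open>param_jacobian_eq_0_iff\<close>), which by Taylor's theorem means that this combination is
  \<open>o((x - a)\<^sup>n)\<close>. Moreover \<open>f\<^sub>x(a) \<noteq> 0\<close>, because it is a factor of \<open>G\<^sub>x(a) = 1\<close>. Hence multiplication by
  \<open>f\<^sub>x\<close> and the substitution \<open>y = f(x)\<close> both preserve this order of vanishing, and the same
  coefficients serve for \<open>G\<close> at \<open>a\<close> and for \<open>H\<close> at \<open>b\<close> (\<open>jets_vanish_iff_transport\<close>). So the Jacobians at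
  \<open>m\<close> and at \<open>m + 1\<close> vanish together whenever \<open>m + 1 < p\<close>
  (\<open>param_jacobian_zero_iff_semiconj\<close>). Being an equivalence, this reaches every index from \<open>j\<close>
  without passing from \<open>p - 1\<close> to \<open>0\<close>; that passage would lead to the orbit point \<open>F\<^sub>0(a\<^sub>0)\<close>, which for
  \<open>k > 1\<close> need not be \<open>a\<^sub>0\<close>.

  What remains is regularity: the compositions must have the derivatives occurring above, and \<open>x\<close>- and
  parameter derivatives must commute. Partial derivatives in a parameter only see a line in
  parameter space, so this is done for families with one real parameter, in a class closed under
  composition (\<open>C_family_compose\<close>).\<close>

section \<open>Jets and order of vanishing\<close>

text \<open>Keeping the whole sequence \<open>w 0, \<dots>, w n\<close> of successive derivatives, instead of a function and an
  operator, lets the same lemmas serve the iterated \<open>x\<close>-derivatives of a function, those of a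
  parameter derivative, and linear combinations of either.\<close>

definition jet_on :: "real set \<Rightarrow> nat \<Rightarrow> (nat \<Rightarrow> real \<Rightarrow> real) \<Rightarrow> bool" where
  "jet_on S n w \<longleftrightarrow>
     (\<forall>i<n. \<forall>x\<in>S. (w i has_real_derivative w (Suc i) x) (at x within S)) \<and>
     (\<forall>i\<le>n. continuous_on S (w i))"

lemma jet_onD:
  assumes "jet_on S n w"
  shows "i < n \<Longrightarrow> x \<in> S \<Longrightarrow> (w i has_real_derivative w (Suc i) x) (at x within S)"
    and "i \<le> n \<Longrightarrow> continuous_on S (w i)"
  using assms by (auto simp: jet_on_def)

lemma jet_on_mono: "jet_on S n w \<Longrightarrow> m \<le> n \<Longrightarrow> jet_on S m w"
  by (auto simp: jet_on_def)

lemma jet_on_diff: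
  assumes "jet_on S n v" "jet_on S n w"
  shows "jet_on S n (\<lambda>i x. v i x - w i x)"
  using assms unfolding jet_on_def
  by (auto intro!: continuous_intros DERIV_diff)

lemma jet_on_linear_combination:
  assumes "\<And>r. jet_on S n (w r)"
  shows "jet_on S n (\<lambda>i x. \<Sum>r\<in>R. c r * w r i x)"
  using assms unfolding jet_on_def
  by (auto intro!: continuous_intros DERIV_sum DERIV_cmult)

text \<open>These are the derivatives of \<open>c (x - a)\<^sup>m / m!\<close>. Subtracting such a jet removes a single Taylor
  coefficient at \<open>a\<close>.\<close>

lemma jet_on_power: "jet_on S n (\<lambda>i x. if i \<le> m then c * (x - a) ^ (m - i) / fact (m - i) else 0)"
proof -
  have "((\<lambda>x. if i \<le> m then c * (x - a) ^ (m - i) / fact (m - i) else 0) has_real_derivative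
          (if Suc i \<le> m then c * (x - a) ^ (m - Suc i) / fact (m - Suc i) else 0)) (at x within S)"
    for i and x :: real
  proof (cases "i < m")
    case True
    then obtain q where q: "m - i = Suc q" "m - Suc i = q" by (metis Suc_diff_Suc)
    have "((\<lambda>x. (x - a) ^ Suc q) has_real_derivative real (Suc q) * (x - a) ^ q) (at x within S)"
      by (auto intro!: derivative_eq_intros simp del: of_nat_Suc power_Suc)
    from DERIV_cmult[OF this, of "c / fact (Suc q)"]
    have "((\<lambda>x. c * (x - a) ^ Suc q / fact (Suc q)) has_real_derivative
          c * (x - a) ^ q / fact q) (at x within S)"
      by (simp add: field_simps del: of_nat_Suc power_Suc)
    then show ?thesis using True q by (simp add: Suc_leI del: power_Suc fact_Suc)
  next
    case False
    then show ?thesis by (cases "i = m") auto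
  qed
  note deriv = this
  show ?thesis
    unfolding jet_on_def
  proof (intro conjI allI impI ballI)
    show "continuous_on S (\<lambda>x. if i \<le> m then c * (x - a) ^ (m - i) / fact (m - i) else 0)" for i
      by (rule DERIV_continuous_on, rule deriv)
  qed (rule deriv)
qed

text \<open>Near \<open>a\<close> the top derivative \<open>w n\<close> is small by continuity, and it bounds the remainder of the Taylor
  expansion of order \<open>n - 1\<close>, all of whose coefficients vanish.\<close>

lemma smallo_if_jet_zero:
  assumes jet: "jet_on S n w" and "convex S" "a \<in> S" and zero: "\<And>i. i \<le> n \<Longrightarrow> w i a = 0"
  shows "w 0 \<in> o[at a within S](\<lambda>x. (x - a) ^ n)"
proof (rule landau_o.smallI)
  fix e :: real assume "e > 0"
  have "continuous_on S (w n)" using jet by (simp add: jet_on_def)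
  then obtain d where "d > 0" and d: "\<And>x. x \<in> S \<Longrightarrow> dist x a < d \<Longrightarrow> dist (w n x) (w n a) < e"
    using \<open>e > 0\<close> \<open>a \<in> S\<close> unfolding continuous_on_iff by blast
  have small: "norm (w n x) \<le> e" if "x \<in> S \<inter> ball a d" for x
    using d[of x] zero[of n] that by (auto simp: dist_commute dist_real_def)
  have bound: "norm (w 0 x) \<le> e * norm ((x - a) ^ n)" if x: "x \<in> S \<inter> ball a d" for x
  proof (cases n)
    case 0
    then show ?thesis using small[OF x] by simp
  next
    case (Suc m)
    have "norm (w 0 x - (\<Sum>i\<le>m. w i a * (x - a) ^ i / fact i)) \<le> e * norm (x - a) ^ Suc m / fact m"
    proof (rule field_Taylor[where S = "S \<inter> ball a d"])
      show "(w i has_field_derivative w (Suc i) y) (at y within S \<inter> ball a d)"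
        if "y \<in> S \<inter> ball a d" "i \<le> m" for i y
        using jet_onD(1)[OF jet, of i y] that Suc by (auto intro: DERIV_subset)
    qed (use assms \<open>d > 0\<close> x small Suc in \<open>auto intro: convex_Int\<close>)
    also have "(\<Sum>i\<le>m. w i a * (x - a) ^ i / fact i) = 0" using zero Suc by simp
    also have "e * norm (x - a) ^ Suc m / fact m \<le> e * norm (x - a) ^ Suc m"
      using \<open>e > 0\<close> fact_ge_1[of m, where 'a = real]
      by (intro divide_left_mono[of 1 "fact m", simplified]) auto
    finally show ?thesis using Suc by (simp add: power_abs abs_mult)
  qed
  have "\<forall>\<^sub>F x in at a within S. x \<in> S \<inter> ball a d"
    using \<open>d > 0\<close> by (auto simp: eventually_at dist_commute)
  then show "\<forall>\<^sub>F x in at a within S. norm (w 0 x) \<le> e * norm ((x - a) ^ n)"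
    by eventually_elim (rule bound)
qed

text \<open>If \<open>w i a\<close> were the first nonzero entry, then \<open>w 0\<close> would behave like a nonzero multiple of
  \<open>(x - a)\<^sup>i\<close> with \<open>i \<le> n\<close>. The filter \<open>F\<close> admits estimates on a part of \<open>S\<close>: the
  image of a fiber under a map may fill only one side of a point of the next fiber.\<close>

lemma jet_zero_if_smallo:
  assumes jet: "jet_on S n w" and "convex S" "a \<in> S"
    and F: "F \<le> at a within S" "F \<noteq> bot" and small: "w 0 \<in> o[F](\<lambda>x. (x - a) ^ n)"
  shows "i \<le> n \<Longrightarrow> w i a = 0"
proof (induction i rule: less_induct)
  case (less i)
  define c where "c = w i a"
  define u where "u = (\<lambda>j x. if j \<le> i then c * (x - a) ^ (i - j) / fact (i - j) else 0)"
  have near: "\<forall>\<^sub>F x in F. x \<in> S \<and> x \<noteq> a \<and> \<bar>x - a\<bar> \<le> 1"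
    by (rule filter_leD[OF F(1)])
       (auto simp: eventually_at dist_real_def intro!: exI[of _ 1])
  have "(\<lambda>x. w 0 x - u 0 x) \<in> o[at a within S](\<lambda>x. (x - a) ^ i)"
  proof (rule smallo_if_jet_zero[where w = "\<lambda>j x. w j x - u j x"])
    show "jet_on S i (\<lambda>j x. w j x - u j x)" unfolding u_def
      by (intro jet_on_diff jet_on_power jet_on_mono[OF jet less.prems])
    show "w j a - u j a = 0" if "j \<le> i" for j
    proof (cases "j = i")
      case False
      then show ?thesis using less that by (auto simp: u_def)
    qed (simp add: u_def c_def)
  qed (use assms in auto)
  then have 1: "(\<lambda>x. w 0 x - u 0 x) \<in> o[F](\<lambda>x. (x - a) ^ i)"
    by (rule landau_o.small.filter_mono[OF F(1)])
  have "(\<lambda>x. (x - a) ^ n) \<in> O[F](\<lambda>x. (x - a) ^ i)"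
  proof (rule landau_o.bigI[of 1])
    show "\<forall>\<^sub>F x in F. norm ((x - a) ^ n) \<le> 1 * norm ((x - a) ^ i)"
      using near by eventually_elim (use less.prems in \<open>auto simp: power_abs intro: power_decreasing\<close>)
  qed simp
  with small have 2: "w 0 \<in> o[F](\<lambda>x. (x - a) ^ i)"
    by (rule landau_o.small_big_trans)
  have "(\<lambda>x. w 0 x - (w 0 x - u 0 x)) \<in> o[F](\<lambda>x. (x - a) ^ i)"
    by (rule sum_in_smallo(2)[OF 2 1])
  then have "(\<lambda>x. (c / fact i) * (x - a) ^ i) \<in> o[F](\<lambda>x. (x - a) ^ i)"
    by (simp add: u_def)
  then have "c \<noteq> 0 \<Longrightarrow> (\<lambda>x. (x - a) ^ i) \<in> o[F](\<lambda>x. (x - a) ^ i)"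
    by (subst (asm) landau_o.small.cmult_in_iff) auto
  moreover have "\<not> (\<forall>\<^sub>F x in F. (x - a) ^ i = 0)"
  proof
    assume "\<forall>\<^sub>F x in F. (x - a) ^ i = 0"
    with near have "\<forall>\<^sub>F x in F. False" by eventually_elim simp
    then show False using F(2) by (simp add: eventually_False)
  qed
  ultimately show ?case
    by (auto simp: c_def landau_o.small_refl_iff)
qed

text \<open>For \<open>n = 0\<close> this is continuity. For \<open>n > 0\<close> the function is Lipschitz near \<open>a\<close>, so the difference
  is bounded by a multiple of \<open>g x - x\<close>.\<close>

lemma smallo_compose_near_identity:
  assumes jet: "jet_on S n w" and "convex S" "a \<in> S"
    and g: "\<And>x. x \<in> S \<Longrightarrow> g x \<in> S" "continuous_on S g" "g a = a"
    and id: "(\<lambda>x. g x - x) \<in> o[at a within S](\<lambda>x. (x - a) ^ n)"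
  shows "(\<lambda>x. w 0 x - w 0 (g x)) \<in> o[at a within S](\<lambda>x. (x - a) ^ n)"
proof (cases n)
  case 0
  have "continuous_on S (\<lambda>x. w 0 x - w 0 (g x))"
    using jet_onD(2)[OF jet, of 0] g
    by (auto intro!: continuous_intros elim!: continuous_on_compose2)
  then have "((\<lambda>x. w 0 x - w 0 (g x)) \<longlongrightarrow> 0) (at a within S)"
    using \<open>a \<in> S\<close> g(3) by (force simp: continuous_on_def)
  then show ?thesis using 0 by (auto intro!: smalloI_tendsto)
next
  case (Suc m)
  have "continuous_on S (w 1)" using jet_onD(2)[OF jet, of 1] Suc by simp
  then obtain d where "d > 0" and d: "\<And>x. x \<in> S \<Longrightarrow> dist x a < d \<Longrightarrow> dist (w 1 x) (w 1 a) < 1"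
    using \<open>a \<in> S\<close> unfolding continuous_on_iff by (metis zero_less_one)
  define B where "B = \<bar>w 1 a\<bar> + 1"
  have lip: "norm (w 0 x - w 0 y) \<le> B * norm (x - y)"
    if "x \<in> S \<inter> ball a d" "y \<in> S \<inter> ball a d" for x y
  proof (rule field_differentiable_bound[where S = "S \<inter> ball a d" and f' = "w 1"])
    show "(w 0 has_field_derivative w 1 z) (at z within S \<inter> ball a d)" if "z \<in> S \<inter> ball a d" for z
      using jet_onD(1)[OF jet, of 0 z] that Suc by (auto intro: DERIV_subset)
    show "norm (w 1 z) \<le> B" if "z \<in> S \<inter> ball a d" for z
      using d[of z] that by (auto simp: dist_commute dist_real_def B_def)
  qed (use that \<open>convex S\<close> in \<open>auto intro: convex_Int\<close>)
  have "(g \<longlongrightarrow> a) (at a within S)" using g \<open>a \<in> S\<close> by (force simp: continuous_on_def)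
  then have "\<forall>\<^sub>F x in at a within S. dist (g x) a < d" using \<open>d > 0\<close> by (rule tendstoD)
  moreover have "\<forall>\<^sub>F x in at a within S. x \<in> S \<inter> ball a d"
    using \<open>d > 0\<close> by (auto simp: eventually_at dist_commute)
  ultimately have "\<forall>\<^sub>F x in at a within S. norm (w 0 x - w 0 (g x)) \<le> B * norm (g x - x)"
  proof eventually_elim
    case (elim x)
    then show ?case using lip[of x "g x"] g(1)[of x] by (simp add: dist_commute abs_minus_commute)
  qed
  then have "(\<lambda>x. w 0 x - w 0 (g x)) \<in> O[at a within S](\<lambda>x. g x - x)"
    by (rule landau_o.bigI[rotated]) (simp add: B_def)
  then show ?thesis using id by (rule landau_o.big_small_trans)
qed

lemma bigtheta_power_if_derivative_nonzero:
  assumes "(\<phi> has_real_derivative c) (at a within S)" "c \<noteq> 0"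
  shows "(\<lambda>x. (\<phi> x - \<phi> a) ^ n) \<in> \<Theta>[at a within S](\<lambda>x. (x - a) ^ n)"
proof (rule bigthetaI_tendsto)
  show "((\<lambda>x. (\<phi> x - \<phi> a) ^ n / (x - a) ^ n) \<longlongrightarrow> c ^ n) (at a within S)"
    using assms(1) unfolding power_divide[symmetric]
    by (intro tendsto_power) (simp add: has_field_derivative_iff)
qed (use assms in simp)

lemma filterlim_at_within_if_derivative_nonzero:
  assumes deriv: "(\<phi> has_real_derivative c) (at a within S)" "c \<noteq> 0"
    and "\<And>x. x \<in> S \<Longrightarrow> \<phi> x \<in> T"
  shows "filterlim \<phi> (at (\<phi> a) within T) (at a within S)"
  unfolding filterlim_at
proof
  show "(\<phi> \<longlongrightarrow> \<phi> a) (at a within S)"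
    using DERIV_continuous[OF deriv(1)] by (simp add: continuous_within)
  have "((\<lambda>x. (\<phi> x - \<phi> a) / (x - a)) \<longlongrightarrow> c) (at a within S)"
    using deriv(1) by (simp add: has_field_derivative_iff)
  then have "\<forall>\<^sub>F x in at a within S. (\<phi> x - \<phi> a) / (x - a) \<noteq> 0"
    using deriv(2) by (rule tendsto_imp_eventually_ne)
  moreover have "\<forall>\<^sub>F x in at a within S. x \<in> S" by (simp add: eventually_at_filter)
  ultimately show "\<forall>\<^sub>F x in at a within S. \<phi> x \<in> T \<and> \<phi> x \<noteq> \<phi> a"
    by eventually_elim (use assms(3) in auto)
qed

text \<open>Both sides say that a function is \<open>o((x - a)\<^sup>n)\<close>: on the left \<open>u 0\<close>, which may be multiplied by
  \<open>\<psi>\<close> because \<open>\<psi>\<close> has a nonzero limit, on the right \<open>w 0 \<circ> \<phi>\<close>, where \<open>\<phi> x - \<phi> a\<close> and \<open>x - a\<close> have the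
  same order of magnitude.\<close>

lemma jets_vanish_iff_transport:
  assumes u: "jet_on S n u" "convex S" "a \<in> S" "at a within S \<noteq> bot"
    and w: "jet_on T n w" "convex T"
    and \<phi>: "\<And>x. x \<in> S \<Longrightarrow> \<phi> x \<in> T" "(\<phi> has_real_derivative c) (at a within S)" "c \<noteq> 0"
    and \<psi>: "(\<psi> \<longlongrightarrow> c') (at a within S)" "c' \<noteq> 0"
    and eq: "(\<lambda>x. \<psi> x * u 0 x - w 0 (\<phi> x)) \<in> o[at a within S](\<lambda>x. (x - a) ^ n)"
  shows "(\<forall>i\<le>n. u i a = 0) \<longleftrightarrow> (\<forall>i\<le>n. w i (\<phi> a) = 0)"
proof -
  let ?F = "at a within S" and ?F' = "filtermap \<phi> (at a within S)"
  have "(\<forall>i\<le>n. u i a = 0) \<longleftrightarrow> u 0 \<in> o[?F](\<lambda>x. (x - a) ^ n)"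
    using smallo_if_jet_zero[OF u(1-3)] jet_zero_if_smallo[OF u(1-3) order_refl u(4)] by blast
  also have "u 0 \<in> o[?F](\<lambda>x. (x - a) ^ n) \<longleftrightarrow> (\<lambda>x. \<psi> x * u 0 x) \<in> o[?F](\<lambda>x. (x - a) ^ n)"
  proof -
    have "\<psi> \<in> \<Theta>[?F](\<lambda>_. 1)" using \<psi> by (intro bigthetaI_tendsto[of c']) auto
    then have "(\<lambda>x. \<psi> x * u 0 x) \<in> \<Theta>[?F](\<lambda>x. 1 * u 0 x)"
      by (intro landau_theta.mult) auto
    then show ?thesis by (simp add: landau_o.small.in_cong_bigtheta)
  qed
  also have "\<dots> \<longleftrightarrow> (\<lambda>x. w 0 (\<phi> x)) \<in> o[?F](\<lambda>x. (x - a) ^ n)"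
    using sum_in_smallo(2)[OF _ eq] sum_in_smallo(1)[OF eq] by fastforce
  also have "\<dots> \<longleftrightarrow> (\<lambda>x. w 0 (\<phi> x)) \<in> o[?F](\<lambda>x. (\<phi> x - \<phi> a) ^ n)"
    by (rule arg_cong[of _ _ "\<lambda>A. _ \<in> A"], rule landau_o.small.cong_bigtheta, subst bigtheta_sym)
       (rule bigtheta_power_if_derivative_nonzero[OF \<phi>(2,3)])
  also have "\<dots> \<longleftrightarrow> w 0 \<in> o[?F'](\<lambda>y. (y - \<phi> a) ^ n)"
    by (simp add: landau_o.small.in_filtermap_iff)
  also have "\<dots> \<longleftrightarrow> (\<forall>i\<le>n. w i (\<phi> a) = 0)"
  proof -
    \<comment> \<open>Near \<open>a\<close> the map \<open>\<phi>\<close> omits the value \<open>\<phi> a\<close>, so the image filter is finer than the punctured one at \<open>\<phi> a\<close>.\<close>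
    have lim: "?F' \<le> at (\<phi> a) within T"
      using filterlim_at_within_if_derivative_nonzero[OF \<phi>(2,3,1)] by (simp add: filterlim_def)
    have "?F' \<noteq> bot" using u(4) by (simp add: filtermap_bot_iff)
    then show ?thesis
      using smallo_if_jet_zero[OF w \<phi>(1)[OF u(3)]]
        jet_zero_if_smallo[OF w \<phi>(1)[OF u(3)] lim]
        landau_o.small.filter_mono[OF lim, of "w 0"] by blast
  qed
  finally show ?thesis .
qed

section \<open>Families with one parameter\<close>

definition has_partials ::
    "real set \<Rightarrow> real set \<Rightarrow> (real \<Rightarrow> real \<Rightarrow> real) \<Rightarrow> (real \<Rightarrow> real \<Rightarrow> real) \<Rightarrow> (real \<Rightarrow> real \<Rightarrow> real) \<Rightarrow> bool"
  where "has_partials S U h hx ht \<longleftrightarrow>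
     (\<forall>x\<in>S. \<forall>t\<in>U. ((\<lambda>y. h y t) has_real_derivative hx x t) (at x within S) \<and>
                  (h x has_real_derivative ht x t) (at t))"

text \<open>For \<open>n > 0\<close>: the \<open>x\<close>-derivatives of all orders below \<open>n\<close> are \<open>C\<^sup>1\<close> jointly in \<open>x\<close> and \<open>t\<close>. The recursive
  form, in which the \<open>x\<close>-derivative of a family lies in the next lower class, makes closure under
  products and compositions a plain induction, without formulas for higher derivatives.\<close>

primrec C_family :: "nat \<Rightarrow> real set \<Rightarrow> real set \<Rightarrow> (real \<Rightarrow> real \<Rightarrow> real) \<Rightarrow> bool" where
  "C_family 0 S U h \<longleftrightarrow> continuous_on (S \<times> U) (\<lambda>(x, t). h x t)"
| "C_family (Suc n) S U h \<longleftrightarrow>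
     (\<exists>hx ht. has_partials S U h hx ht \<and> C_family n S U hx \<and>
              continuous_on (S \<times> U) (\<lambda>(x, t). ht x t))"

lemma has_partialsD:
  assumes "has_partials S U h hx ht" "x \<in> S" "t \<in> U"
  shows "((\<lambda>y. h y t) has_real_derivative hx x t) (at x within S)"
    and "(h x has_real_derivative ht x t) (at t)"
  using assms by (auto simp: has_partials_def)

lemma has_partials_imp_has_derivative:
  assumes h: "has_partials S U h hx ht" and ht: "continuous_on (S \<times> U) (\<lambda>(x, t). ht x t)"
    and "convex U" "x \<in> S" "t \<in> U"
  shows "((\<lambda>(x, t). h x t) has_derivative (\<lambda>(dx, dt). hx x t * dx + ht x t * dt))
           (at (x, t) within S \<times> U)"
proof -
  have "((\<lambda>(x, t). h x t) has_derivative
          (\<lambda>(dx, dt). hx x t * dx + blinfun_apply (blinfun_mult_right (ht x t)) dt))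
        (at (x, t) within S \<times> U)"
  proof (rule has_derivative_partialsI)
    show "((\<lambda>x. h x t) has_derivative (*) (hx x t)) (at x within S)"
      using has_partialsD(1)[OF h] assms by (simp add: has_field_derivative_def)
    show "(h x has_derivative blinfun_apply (blinfun_mult_right (ht x t))) (at t within U)"
      if "x \<in> S" "t \<in> U" for x t
      using has_partialsD(2)[OF h that, THEN has_field_derivative_at_within, of U]
      by (simp add: has_field_derivative_def)
    have "continuous_on (S \<times> U) (\<lambda>p. blinfun_mult_right (case p of (x, t) \<Rightarrow> ht x t))"
      by (rule bounded_linear.continuous_on[OF bounded_linear_blinfun_mult_right ht])
    then show "continuous (at (x, t) within S \<times> U) (\<lambda>(x, t). blinfun_mult_right (ht x t))"
      using assms by (simp add: continuous_on_eq_continuous_within case_prod_unfold)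
  qed fact+
  then show ?thesis by simp
qed

lemma has_partials_imp_continuous_on:
  assumes "has_partials S U h hx ht" "continuous_on (S \<times> U) (\<lambda>(x, t). ht x t)" "convex U"
  shows "continuous_on (S \<times> U) (\<lambda>(x, t). h x t)"
  using has_derivative_continuous[OF has_partials_imp_has_derivative[OF assms]]
  by (auto simp: continuous_on_eq_continuous_within)

lemma C_family_Suc_imp:
  assumes "convex U"
  shows "C_family (Suc n) S U h \<Longrightarrow> C_family n S U h"
proof (induction n arbitrary: h)
  case 0
  then show ?case using has_partials_imp_continuous_on assms by auto
next
  case (Suc n)
  from Suc.prems obtain hx ht where "has_partials S U h hx ht" "C_family (Suc n) S U hx"
    "continuous_on (S \<times> U) (\<lambda>(x, t). ht x t)" by (subst (asm) C_family.simps) blast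
  with Suc.IH[of hx] show ?case by (subst C_family.simps) blast
qed

lemma C_family_imp_continuous_on:
  assumes "convex U" "C_family n S U h"
  shows "continuous_on (S \<times> U) (\<lambda>(x, t). h x t)"
  using assms(2) by (induction n) (auto dest: C_family_Suc_imp[OF assms(1)] simp del: C_family.simps(2))

lemma C_family_cong:
  assumes "open U" "\<And>x t. x \<in> S \<Longrightarrow> t \<in> U \<Longrightarrow> h x t = h' x t" "C_family n S U h"
  shows "C_family n S U h'"
proof (cases n)
  case 0
  have "continuous_on (S \<times> U) (\<lambda>(x, t). h' x t) \<longleftrightarrow> continuous_on (S \<times> U) (\<lambda>(x, t). h x t)"
    by (rule continuous_on_cong) (use assms(2) in auto)
  then show ?thesis using assms(3) 0 by simp
next
  case (Suc m)
  then obtain hx ht where h: "has_partials S U h hx ht" "C_family m S U hx"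
    "continuous_on (S \<times> U) (\<lambda>(x, t). ht x t)" using assms(3) by auto
  have "has_partials S U h' hx ht"
    unfolding has_partials_def
  proof (intro ballI conjI)
    fix x t assume xt: "x \<in> S" "t \<in> U"
    show "((\<lambda>y. h' y t) has_real_derivative hx x t) (at x within S)"
      using has_partialsD(1)[OF h(1) xt]
      by (rule has_field_derivative_transform_within[OF _ zero_less_one])
         (use assms xt in auto)
    show "(h' x has_real_derivative ht x t) (at t)"
      using has_partialsD(2)[OF h(1) xt]
      by (rule has_field_derivative_transform_within_open) (use assms xt in auto)
  qed
  with h Suc show ?thesis by auto
qed

lemma C_family_add:
  assumes "C_family n S U g" "C_family n S U h"
  shows "C_family n S U (\<lambda>x t. g x t + h x t)"
  using assms
proof (induction n arbitrary: g h)
  case 0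
  then show ?case by (auto simp: case_prod_unfold intro!: continuous_intros)
next
  case (Suc n)
  then obtain gx gt hx ht where
    g: "has_partials S U g gx gt" "C_family n S U gx" "continuous_on (S \<times> U) (\<lambda>(x, t). gt x t)" and
    h: "has_partials S U h hx ht" "C_family n S U hx" "continuous_on (S \<times> U) (\<lambda>(x, t). ht x t)"
    by auto
  have "has_partials S U (\<lambda>x t. g x t + h x t) (\<lambda>x t. gx x t + hx x t) (\<lambda>x t. gt x t + ht x t)"
    using g(1) h(1) unfolding has_partials_def by (auto intro: DERIV_add)
  moreover have "continuous_on (S \<times> U) (\<lambda>(x, t). gt x t + ht x t)"
    using g(3) h(3) by (auto simp: case_prod_unfold intro!: continuous_intros)
  ultimately show ?case using Suc.IH[OF g(2) h(2)] by auto
qed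

lemma C_family_mult:
  assumes "convex U" "C_family n S U g" "C_family n S U h"
  shows "C_family n S U (\<lambda>x t. g x t * h x t)"
  using assms(2,3)
proof (induction n arbitrary: g h)
  case 0
  then show ?case by (auto simp: case_prod_unfold intro!: continuous_intros)
next
  case (Suc n)
  then obtain gx gt hx ht where
    g: "has_partials S U g gx gt" "C_family n S U gx" "continuous_on (S \<times> U) (\<lambda>(x, t). gt x t)" and
    h: "has_partials S U h hx ht" "C_family n S U hx" "continuous_on (S \<times> U) (\<lambda>(x, t). ht x t)"
    by auto
  have "has_partials S U (\<lambda>x t. g x t * h x t)
          (\<lambda>x t. gx x t * h x t + hx x t * g x t) (\<lambda>x t. gt x t * h x t + ht x t * g x t)"
    using g(1) h(1) unfolding has_partials_def by (auto intro: DERIV_mult)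
  moreover have "continuous_on (S \<times> U) (\<lambda>(x, t). gt x t * h x t + ht x t * g x t)"
    using g(3) h(3) Suc.prems[THEN C_family_imp_continuous_on[OF \<open>convex U\<close>]]
    by (auto simp: case_prod_unfold intro!: continuous_intros)
  moreover have "C_family n S U (\<lambda>x t. gx x t * h x t + hx x t * g x t)"
    using g(2) h(2) Suc.prems[THEN C_family_Suc_imp[OF \<open>convex U\<close>]]
    by (intro C_family_add Suc.IH)
  ultimately show ?case by auto
qed

text \<open>The parameter enters \<open>h (g x t) t\<close> twice, which calls for total differentiability of \<open>h\<close> on
  \<open>T \<times> U\<close>; continuity of the one partial derivative \<open>ht\<close> suffices for it.\<close>

lemma has_partials_compose:
  assumes U: "open U" "convex U"
    and g: "has_partials S U g gx gt" and gT: "\<And>x t. x \<in> S \<Longrightarrow> t \<in> U \<Longrightarrow> g x t \<in> T"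
    and h: "has_partials T U h hx ht" and ht: "continuous_on (T \<times> U) (\<lambda>(x, t). ht x t)"
  shows "has_partials S U (\<lambda>x t. h (g x t) t) (\<lambda>x t. hx (g x t) t * gx x t)
           (\<lambda>x t. hx (g x t) t * gt x t + ht (g x t) t)"
  unfolding has_partials_def
proof (intro ballI conjI)
  fix x t assume x: "x \<in> S" and t: "t \<in> U"
  have "((\<lambda>y. h y t) has_real_derivative hx (g x t) t) (at (g x t) within (\<lambda>y. g y t) ` S)"
    by (rule DERIV_subset[OF has_partialsD(1)[OF h gT[OF x t] t]]) (use gT t in auto)
  from DERIV_image_chain[OF this has_partialsD(1)[OF g x t]]
  show "((\<lambda>y. h (g y t) t) has_real_derivative hx (g x t) t * gx x t) (at x within S)"
    by (simp add: o_def)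
  have inner: "((\<lambda>s. (g x s, s)) has_derivative (\<lambda>ds. (gt x t * ds, ds))) (at t within U)"
    using has_partialsD(2)[OF g x t, THEN has_field_derivative_at_within, of U]
    unfolding has_field_derivative_def by (rule has_derivative_Pair[OF _ has_derivative_ident])
  have outer: "((\<lambda>(y, s). h y s) has_derivative (\<lambda>(dy, ds). hx (g x t) t * dy + ht (g x t) t * ds))
          (at (g x t, t) within (\<lambda>s. (g x s, s)) ` U)"
    by (rule has_derivative_subset[OF has_partials_imp_has_derivative[OF h ht U(2) gT[OF x t] t]])
       (use gT x in auto)
  from has_derivative_in_compose[OF inner outer] have "((\<lambda>s. h (g x s) s) has_derivative
          (\<lambda>ds. hx (g x t) t * (gt x t * ds) + ht (g x t) t * ds)) (at t)"
    using at_within_open[OF t U(1)] by simp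
  then show "((\<lambda>s. h (g x s) s) has_real_derivative hx (g x t) t * gt x t + ht (g x t) t) (at t)"
    unfolding has_field_derivative_def
    by (rule has_derivative_eq_rhs) (simp add: fun_eq_iff algebra_simps)
qed

lemma continuous_on_compose_family:
  assumes "continuous_on (T \<times> U) (\<lambda>(x, t). h x t)" "continuous_on (S \<times> U) (\<lambda>(x, t). g x t)"
    and "\<And>x t. x \<in> S \<Longrightarrow> t \<in> U \<Longrightarrow> g x t \<in> T"
  shows "continuous_on (S \<times> U) (\<lambda>(x, t). h (g x t) t)"
proof -
  have "continuous_on (S \<times> U) (\<lambda>p. (case p of (x, t) \<Rightarrow> g x t, snd p))"
    by (intro continuous_on_Pair assms(2) continuous_on_snd continuous_on_id)
  then have "continuous_on (S \<times> U) (\<lambda>p. (\<lambda>(x, t). h x t) (case p of (x, t) \<Rightarrow> g x t, snd p))"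
    by (rule continuous_on_compose2[OF assms(1)]) (use assms(3) in auto)
  then show ?thesis by (simp add: case_prod_unfold)
qed

text \<open>The \<open>x\<close>-derivative of the composition is \<open>(h\<^sub>x \<circ> g) g\<^sub>x\<close>: the first factor is again a composition, so
  the induction hypothesis applies to it, and the class is closed under products. The derivative in
  the parameter contains \<open>h\<^sub>x\<close> as well, since \<open>t\<close> also moves the point \<open>g x t\<close>.\<close>

lemma C_family_compose:
  assumes U: "open U" "convex U" and gT: "\<And>x t. x \<in> S \<Longrightarrow> t \<in> U \<Longrightarrow> g x t \<in> T"
    and "C_family n S U g" "C_family n T U h"
  shows "C_family n S U (\<lambda>x t. h (g x t) t)"
  using assms(4,5)
proof (induction n arbitrary: h)
  case 0
  then show ?case using continuous_on_compose_family[of T U h S g] gT by simp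
next
  case (Suc n)
  obtain gx gt where g: "has_partials S U g gx gt" "C_family n S U gx"
      "continuous_on (S \<times> U) (\<lambda>(x, t). gt x t)"
    using Suc.prems(1) by auto
  obtain hx ht where h: "has_partials T U h hx ht" "C_family n T U hx"
      "continuous_on (T \<times> U) (\<lambda>(x, t). ht x t)"
    using Suc.prems(2) by auto
  note gc = C_family_imp_continuous_on[OF U(2) Suc.prems(1)]
  have "C_family n S U (\<lambda>x t. hx (g x t) t)"
    by (rule Suc.IH[OF C_family_Suc_imp[OF U(2) Suc.prems(1)] h(2)])
  then have 1: "C_family n S U (\<lambda>x t. hx (g x t) t * gx x t)"
    using g(2) by (rule C_family_mult[OF U(2)])
  have "continuous_on (S \<times> U) (\<lambda>(x, t). hx (g x t) t)"
    by (rule continuous_on_compose_family[OF C_family_imp_continuous_on[OF U(2) h(2)] gc gT])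
  moreover have "continuous_on (S \<times> U) (\<lambda>(x, t). ht (g x t) t)"
    by (rule continuous_on_compose_family[OF h(3) gc gT])
  ultimately have 2: "continuous_on (S \<times> U) (\<lambda>(x, t). hx (g x t) t * gt x t + ht (g x t) t)"
    using g(3) unfolding case_prod_unfold by (intro continuous_on_add continuous_on_mult)
  have 3: "has_partials S U (\<lambda>x t. h (g x t) t) (\<lambda>x t. hx (g x t) t * gx x t)
             (\<lambda>x t. hx (g x t) t * gt x t + ht (g x t) t)"
    by (rule has_partials_compose[OF U g(1) gT h(1,3)])
  show ?case using 1 2 3 unfolding C_family.simps by blast
qed

lemma C_family_const: "C_family n S U (\<lambda>x t. c)"
proof (induction n arbitrary: c)
  case (Suc n)
  have "has_partials S U (\<lambda>x t. c) (\<lambda>x t. 0) (\<lambda>x t. 0)" by (simp add: has_partials_def)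
  moreover have "continuous_on (S \<times> U) (\<lambda>(x, t). 0 :: real)" by (simp add: case_prod_unfold)
  ultimately show ?case using Suc[of 0] unfolding C_family.simps by blast
qed (simp add: case_prod_unfold)

lemma C_family_id: "C_family n S U (\<lambda>x t. x)"
proof (cases n)
  case 0
  have "continuous_on (S \<times> U) fst" by (rule continuous_on_fst[OF continuous_on_id])
  then show ?thesis using 0 by (simp add: case_prod_unfold)
next
  case (Suc m)
  have "has_partials S U (\<lambda>x t. x) (\<lambda>x t. 1) (\<lambda>x t. 0)" by (simp add: has_partials_def)
  moreover have "continuous_on (S \<times> U) (\<lambda>(x, t). 0 :: real)" by (simp add: case_prod_unfold)
  ultimately show ?thesis using C_family_const[of m S U 1] unfolding Suc C_family.simps by blast
qed

text \<open>Interchange of the two derivatives, from the continuity of \<open>h\<^sub>x\<^sub>t\<close> alone. The difference quotient in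
  \<open>x\<close> of the difference quotient in \<open>t\<close> is estimated by the mean value inequality, first in \<open>x\<close> and
  then in \<open>t\<close>; the bound does not depend on the increment \<open>s - t\<close>, which is then sent to \<open>0\<close>.\<close>

lemma has_real_derivative_param_derivative:
  assumes U: "open U" "convex U" and "convex S"
    and h: "has_partials S U h hx ht" and hx: "has_partials S U hx hxx hxt"
    and hxt: "continuous_on (S \<times> U) (\<lambda>(x, t). hxt x t)"
    and "x \<in> S" "t \<in> U"
  shows "((\<lambda>y. ht y t) has_real_derivative hxt x t) (at x within S)"
  unfolding has_field_derivative_def has_derivative_within_alt
proof (intro conjI allI impI)
  show "bounded_linear ((*) (hxt x t))" by (rule bounded_linear_mult_right)
  fix e :: real assume "e > 0"
  from hxt \<open>x \<in> S\<close> \<open>t \<in> U\<close> \<open>e > 0\<close> obtain d where "d > 0"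
    and d: "\<And>y s. y \<in> S \<Longrightarrow> s \<in> U \<Longrightarrow> dist (y, s) (x, t) < d \<Longrightarrow> \<bar>hxt y s - hxt x t\<bar> < e"
    unfolding continuous_on_iff dist_real_def by fastforce
  have bound: "\<bar>ht y t - ht x t - hxt x t * (y - x)\<bar> \<le> e * \<bar>y - x\<bar>" if y: "y \<in> S" "\<bar>y - x\<bar> < d / 2" for y
  proof -
    \<comment> \<open>the deviation from \<open>h\<^sub>x\<^sub>t (y - x)\<close> of the double difference divided by \<open>s - t\<close>\<close>
    let ?q = "\<lambda>s. (h y s - h y t) / (s - t) - (h x s - h x t) / (s - t) - hxt x t * (y - x)"
    have slope: "((\<lambda>s. (h z s - h z t) / (s - t)) \<longlongrightarrow> ht z t) (at t)" if "z \<in> S" for z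
      using has_partialsD(2)[OF h that \<open>t \<in> U\<close>] by (simp add: has_field_derivative_iff)
    have lim: "((\<lambda>s. \<bar>?q s\<bar>) \<longlongrightarrow> \<bar>ht y t - ht x t - hxt x t * (y - x)\<bar>) (at t)"
      by (intro tendsto_intros slope y \<open>x \<in> S\<close>)
    have q: "\<bar>?q s\<bar> \<le> e * \<bar>y - x\<bar>" if s: "s \<in> U" "s \<noteq> t" "\<bar>s - t\<bar> < d / 2" for s
    proof -
      let ?Q = "\<lambda>z. h z s - h z t - (s - t) * hxt x t * z"
      let ?C = "S \<inter> ball x (d / 2)"
      have "norm (?Q y - ?Q x) \<le> (e * \<bar>s - t\<bar>) * norm (y - x)"
      proof (rule field_differentiable_bound[where S = ?C
            and f' = "\<lambda>z. hx z s - hx z t - (s - t) * hxt x t"])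
        show "convex ?C" using \<open>convex S\<close> by (intro convex_Int) auto
        fix z assume z: "z \<in> ?C"
        have "((\<lambda>z. h z s - h z t - (s - t) * hxt x t * z) has_real_derivative
                hx z s - hx z t - (s - t) * hxt x t) (at z within S)"
          using z s \<open>t \<in> U\<close> by (auto intro!: derivative_eq_intros has_partialsD(1)[OF h])
        then show "(?Q has_field_derivative hx z s - hx z t - (s - t) * hxt x t) (at z within ?C)"
          by (rule DERIV_subset) auto
        have seg: "closed_segment t s \<subseteq> U"
          using U(2) s \<open>t \<in> U\<close> by (simp add: closed_segment_subset)
        have "norm ((hx z s - s * hxt x t) - (hx z t - t * hxt x t)) \<le> e * norm (s - t)"
        proof (rule field_differentiable_bound[where S = "closed_segment t s"
              and f' = "\<lambda>r. hxt z r - hxt x t"])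
          fix r assume r: "r \<in> closed_segment t s"
          show "((\<lambda>r. hx z r - r * hxt x t) has_field_derivative hxt z r - hxt x t)
                  (at r within closed_segment t s)"
            using has_partialsD(2)[OF hx, of z r, THEN has_field_derivative_at_within] z r seg
            by (auto intro!: derivative_eq_intros)
          have "\<bar>r - t\<bar> \<le> \<bar>s - t\<bar>" using r by (auto simp: closed_segment_eq_real_ivl split: if_splits)
          have "dist (z, r) (x, t) \<le> \<bar>z - x\<bar> + \<bar>r - t\<bar>"
            using norm_Pair_le[of "z - x" "r - t"] by (simp add: dist_norm)
          also have "\<dots> < d"
            using z \<open>\<bar>r - t\<bar> \<le> \<bar>s - t\<bar>\<close> s by (auto simp: dist_real_def abs_minus_commute)
          finally show "norm (hxt z r - hxt x t) \<le> e"
            using d[of z r] z r seg by auto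
        qed auto
        then show "norm (hx z s - hx z t - (s - t) * hxt x t) \<le> e * \<bar>s - t\<bar>"
          by (simp add: algebra_simps)
      qed (use y \<open>x \<in> S\<close> \<open>d > 0\<close> in \<open>auto simp: dist_real_def abs_minus_commute\<close>)
      moreover have "u * (A / u - B / u - C) = A - B - u * C" if "u \<noteq> 0" for u A B C :: real
        using that by (simp add: field_simps)
      from this[of "s - t" "h y s - h y t" "h x s - h x t" "hxt x t * (y - x)"]
      have "(s - t) * ?q s = (h y s - h y t) - (h x s - h x t) - (s - t) * (hxt x t * (y - x))"
        using s by simp
      then have "?Q y - ?Q x = (s - t) * ?q s"
        by (simp only:) (simp add: algebra_simps)
      ultimately have "\<bar>s - t\<bar> * \<bar>?q s\<bar> \<le> \<bar>s - t\<bar> * (e * \<bar>y - x\<bar>)"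
        by (simp add: abs_mult mult_ac)
      then show ?thesis using s by (simp add: mult_le_cancel_left)
    qed
    obtain r where r: "r > 0" "ball t r \<subseteq> U" using U(1) \<open>t \<in> U\<close> openE by blast
    have "\<forall>\<^sub>F s in at t. \<bar>?q s\<bar> \<le> e * \<bar>y - x\<bar>"
      unfolding eventually_at
      by (rule exI[of _ "min r (d / 2)"])
         (use r \<open>d > 0\<close> q in \<open>auto simp: dist_real_def abs_minus_commute subset_iff\<close>)
    then show ?thesis by (rule tendsto_upperbound[OF lim]) simp
  qed
  show "\<exists>d>0. \<forall>y\<in>S. norm (y - x) < d \<longrightarrow> norm (ht y t - ht x t - hxt x t * (y - x)) \<le> e * norm (y - x)"
    using bound \<open>d > 0\<close> by (intro exI[of _ "d / 2"]) auto
qed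

section \<open>Iterated fiber derivatives and their parameter derivatives\<close>

lemma nth_deriv_Suc_right: "nth_deriv S (Suc n) g = nth_deriv S n (nth_deriv S 1 g)"
  by (induction n) simp_all

lemma dx_0 [simp]: "dx S 0 h = h"
  by (simp add: dx_def fun_eq_iff)

lemma dx_dx_1: "dx S i (dx S 1 h) = dx S (Suc i) h"
  unfolding dx_def nth_deriv_Suc_right by (simp add: fun_eq_iff)

lemma dx_1_dx: "dx S 1 (dx S i h) = dx S (Suc i) h"
  by (simp add: dx_def fun_eq_iff)

lemma dx_1_eq:
  assumes "((\<lambda>y. h y t) has_real_derivative D) (at x within S)" "at x within S \<noteq> bot"
  shows "dx S 1 h x t = D"
  using assms vector_derivative_within[OF assms(2)]
  by (simp add: dx_def has_real_derivative_iff_has_vector_derivative)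

text \<open>At these points derivatives within \<open>S\<close> are unique, so that the derivatives chosen by
  \<^const>\<open>vector_derivative\<close> in \<^const>\<open>dx\<close> are the actual ones.\<close>

definition no_isolated_points :: "real set \<Rightarrow> bool" where
  "no_isolated_points S \<longleftrightarrow> (\<forall>x\<in>S. at x within S \<noteq> bot)"

lemma no_isolated_points_interval:
  assumes "is_interval S" "interior S \<noteq> {}"
  shows "no_isolated_points S"
proof -
  have "S \<noteq> {x}" for x using assms(2) by auto
  then show ?thesis
    using connected_imp_perfect[of S] assms(1)
    by (auto simp: no_isolated_points_def trivial_limit_within is_interval_connected)
qed

text \<open>The witnesses in the definition of \<^const>\<open>C_family\<close> agree on \<open>S \<times> U\<close> with the canonical derivatives.
  The class only looks at \<open>S \<times> U\<close>, so they may be exchanged.\<close>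

lemma C_family_SucD:
  assumes "open U" "no_isolated_points S" "C_family (Suc n) S U h"
  shows "has_partials S U h (dx S 1 h) (\<lambda>x t. deriv (h x) t)"
    and "C_family n S U (dx S 1 h)"
    and "continuous_on (S \<times> U) (\<lambda>(x, t). deriv (h x) t)"
proof -
  obtain hx ht where h: "has_partials S U h hx ht" "C_family n S U hx"
    "continuous_on (S \<times> U) (\<lambda>(x, t). ht x t)" using assms(3) by auto
  have hx: "dx S 1 h x t = hx x t" if "x \<in> S" "t \<in> U" for x t
    using dx_1_eq[of h t] has_partialsD(1)[OF h(1) that] assms(2) that
    by (simp add: no_isolated_points_def)
  have ht: "deriv (h x) t = ht x t" if "x \<in> S" "t \<in> U" for x t
    using has_partialsD(2)[OF h(1) that] by (rule DERIV_imp_deriv)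
  show "has_partials S U h (dx S 1 h) (\<lambda>x t. deriv (h x) t)"
    using h(1) by (simp add: has_partials_def hx ht del: One_nat_def)
  show "C_family n S U (dx S 1 h)"
    by (rule C_family_cong[OF assms(1) _ h(2)]) (simp only: hx)
  have "continuous_on (S \<times> U) (\<lambda>(x, t). deriv (h x) t) \<longleftrightarrow> continuous_on (S \<times> U) (\<lambda>(x, t). ht x t)"
    by (rule continuous_on_cong) (auto simp: ht)
  then show "continuous_on (S \<times> U) (\<lambda>(x, t). deriv (h x) t)" using h(3) by simp
qed

lemma C_family_dx:
  assumes "open U" "no_isolated_points S"
  shows "C_family (i + n) S U h \<Longrightarrow> C_family n S U (dx S i h)"
proof (induction i arbitrary: h)
  case (Suc i)
  then have "C_family (i + n) S U (dx S 1 h)"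
    using C_family_SucD(2)[OF assms, of "i + n"] by (simp del: C_family.simps)
  from Suc.IH[OF this] show ?case by (simp add: dx_dx_1 del: One_nat_def)
qed simp

lemma C_family_if_iterated_partials:
  assumes "\<And>i. i < n \<Longrightarrow> has_partials S U (dx S i h) (dx S (Suc i) h) (ht i)"
    and "\<And>i. i < n \<Longrightarrow> continuous_on (S \<times> U) (\<lambda>(x, t). ht i x t)"
    and "continuous_on (S \<times> U) (\<lambda>(x, t). dx S n h x t)"
  shows "C_family n S U h"
proof -
  have "C_family m S U (dx S (n - m) h)" if "m \<le> n" for m
    using that
  proof (induction m)
    case 0
    then show ?case using assms(3) by simp
  next
    case (Suc m)
    then have "n - m = Suc (n - Suc m)" by simp
    with Suc assms(1,2)[of "n - Suc m"] show ?case by auto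
  qed
  from this[of n] show ?thesis by simp
qed

lemma jet_on_dx:
  assumes U: "open U" "convex U" and S: "no_isolated_points S"
    and h: "C_family n S U h" and t: "t \<in> U"
  shows "jet_on S n (\<lambda>i x. dx S i h x t)"
  unfolding jet_on_def
proof (intro conjI allI impI ballI)
  fix i x assume "i < n" "x \<in> S"
  then have "C_family (Suc (n - Suc i)) S U (dx S i h)"
    using C_family_dx[OF U(1) S, of i "n - i" h] h by (simp add: Suc_diff_Suc)
  from has_partialsD(1)[OF C_family_SucD(1)[OF U(1) S this] \<open>x \<in> S\<close> t]
  show "((\<lambda>x. dx S i h x t) has_real_derivative dx S (Suc i) h x t) (at x within S)"
    by (simp only: dx_1_dx)
next
  fix i assume "i \<le> n"
  then have "C_family (n - i) S U (dx S i h)"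
    using C_family_dx[OF U(1) S, of i "n - i" h] h by simp
  from C_family_imp_continuous_on[OF U(2) this]
  have "continuous_on S (\<lambda>x. (\<lambda>(x, t). dx S i h x t) (x, t))"
    by (rule continuous_on_compose2) (use t in \<open>auto intro!: continuous_intros\<close>)
  then show "continuous_on S (\<lambda>x. dx S i h x t)" by simp
qed

text \<open>Interchanging derivatives once for each order turns the entries of a column of the Jacobian matrix
  into the successive \<open>x\<close>-derivatives of a single parameter derivative.\<close>

lemma jet_on_param_derivative:
  assumes U: "open U" "convex U" and S: "convex S" "no_isolated_points S"
    and h: "C_family (Suc n) S U h" and t: "t \<in> U"
  shows "jet_on S n (\<lambda>i x. deriv (dx S i h x) t)"
  unfolding jet_on_def
proof (intro conjI allI impI ballI)
  fix i x assume "i < n" "x \<in> S"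
  then have i: "C_family (Suc (Suc (n - Suc i))) S U (dx S i h)"
    using C_family_dx[OF U(1) S(2), of i "Suc n - i" h] h by (simp add: Suc_diff_Suc Suc_diff_le)
  from C_family_SucD(2)[OF U(1) S(2) this]
  have Si: "C_family (Suc (n - Suc i)) S U (dx S (Suc i) h)" by (simp only: dx_1_dx)
  show "((\<lambda>x. deriv (dx S i h x) t) has_real_derivative deriv (dx S (Suc i) h x) t) (at x within S)"
    using C_family_SucD(1)[OF U(1) S(2) i]
    by (intro has_real_derivative_param_derivative[OF U S(1) _ C_family_SucD(1,3)[OF U(1) S(2) Si]
          \<open>x \<in> S\<close> t]) (simp only: dx_1_dx)
next
  fix i assume "i \<le> n"
  then have "C_family (Suc (n - i)) S U (dx S i h)"
    using C_family_dx[OF U(1) S(2), of i "Suc n - i" h] h by (simp add: Suc_diff_le)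
  from C_family_SucD(3)[OF U(1) S(2) this]
  have "continuous_on S (\<lambda>x. (\<lambda>(x, t). deriv (dx S i h x) t) (x, t))"
    by (rule continuous_on_compose2) (use t in \<open>auto intro!: continuous_intros\<close>)
  then show "continuous_on S (\<lambda>x. deriv (dx S i h x) t)" by simp
qed

section \<open>Compositions of maps between fibers\<close>

definition fiber_map ::
    "nat \<Rightarrow> real set \<Rightarrow> real set \<Rightarrow> real set \<Rightarrow> (real \<Rightarrow> real \<Rightarrow> real) \<Rightarrow> bool" where
  "fiber_map n U S T h \<longleftrightarrow> C_family n S U h \<and> (\<forall>x\<in>S. \<forall>t\<in>U. h x t \<in> T)"

lemma fiber_map_id: "fiber_map n U S S (\<lambda>x t. x)"
  by (simp add: fiber_map_def C_family_id)

lemma fiber_map_compose: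
  assumes "open U" "convex U" "fiber_map n U R S g" "fiber_map n U S T h"
  shows "fiber_map n U R T (\<lambda>x t. h (g x t) t)"
  using assms C_family_compose[OF assms(1,2), of R g S n h] by (auto simp: fiber_map_def)

lemma fiber_map_iter_x:
  assumes "open U" "convex U" "fiber_map n U S S h"
  shows "fiber_map n U S S (iter_x k h)"
proof (induction k)
  case 0
  then show ?case using fiber_map_id by (simp add: iter_x_def)
next
  case (Suc k)
  then show ?case using fiber_map_compose[OF assms(1,2) Suc assms(3)] by (simp add: iter_x_def)
qed

lemma fiber_map_fold_upt:
  assumes U: "open U" "convex U"
    and f: "\<And>i. i < p \<Longrightarrow> fiber_map n U (I i) (I ((i + 1) mod p)) (f i)"
    and "m < p"
  shows "m \<le> q \<Longrightarrow> q \<le> p \<Longrightarrow> fiber_map n U (I m) (I (q mod p)) (\<lambda>x t. fold (\<lambda>i y. f i y t) [m..<q] x)"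
proof (induction q rule: dec_induct)
  case base
  then show ?case using fiber_map_id \<open>m < p\<close> by simp
next
  case (step q)
  then have "fiber_map n U (I m) (I q) (\<lambda>x t. fold (\<lambda>i y. f i y t) [m..<q] x)" by simp
  from fiber_map_compose[OF U this f[of q]] step show ?case by simp
qed

text \<open>With \<open>l = m\<close> this is the cyclic composition \<open>F\<^sub>m\<close>. With \<open>l = m + 1\<close> it is what remains of \<open>F\<^sub>m\<close> after
  the first map \<open>f\<^sub>m\<close>.\<close>

lemma fiber_map_fold_wrap:
  assumes U: "open U" "convex U"
    and f: "\<And>i. i < p \<Longrightarrow> fiber_map n U (I i) (I ((i + 1) mod p)) (f i)"
    and "l < p" "m < p"
  shows "fiber_map n U (I l) (I m) (\<lambda>x t. fold (\<lambda>i y. f i y t) ([l..<p] @ [0..<m]) x)"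
proof -
  have "fiber_map n U (I l) (I 0) (\<lambda>x t. fold (\<lambda>i y. f i y t) [l..<p] x)"
    using fiber_map_fold_upt[where I = I and f = f, OF U f \<open>l < p\<close>, of p] \<open>l < p\<close> by simp
  moreover have "fiber_map n U (I 0) (I m) (\<lambda>x t. fold (\<lambda>i y. f i y t) [0..<m] x)"
    using fiber_map_fold_upt[where I = I and f = f and p = p, OF U f, of 0 m] \<open>m < p\<close> by simp
  ultimately show ?thesis using fiber_map_compose[OF U] by simp
qed

text \<open>Applied to \<open>F\<^sub>m\<^sup>k = g \<circ> f\<^sub>m\<close>, this shows that \<open>\<partial>\<^sub>xf\<^sub>m\<close> cannot vanish at a point where \<open>\<partial>\<^sub>xF\<^sub>m\<^sup>k = 1\<close>.\<close>

lemma dx_1_compose: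
  assumes U: "open U" "convex U" and S: "no_isolated_points S" and T: "no_isolated_points T"
    and f: "fiber_map (Suc n) U S T f" and g: "C_family (Suc n) T U g" and "a \<in> S" "t \<in> U"
  shows "dx S 1 (\<lambda>x t. g (f x t) t) a t = dx T 1 g (f a t) t * dx S 1 f a t"
proof (rule dx_1_eq)
  have Cf: "C_family (Suc n) S U f" and fT: "\<And>x t. x \<in> S \<Longrightarrow> t \<in> U \<Longrightarrow> f x t \<in> T"
    using f by (auto simp: fiber_map_def simp del: C_family.simps)
  show "((\<lambda>x. g (f x t) t) has_real_derivative dx T 1 g (f a t) t * dx S 1 f a t) (at a within S)"
    by (rule has_partialsD(1)[OF has_partials_compose[OF U C_family_SucD(1)[OF U(1) S Cf] fT
          C_family_SucD(1,3)[OF U(1) T g]] \<open>a \<in> S\<close> \<open>t \<in> U\<close>])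
  show "at a within S \<noteq> bot" using S \<open>a \<in> S\<close> by (simp add: no_isolated_points_def)
qed

lemma funpow_semiconj:
  assumes "\<And>x. \<phi> (g x) = h (\<phi> x)"
  shows "\<phi> ((g ^^ k) x) = (h ^^ k) (\<phi> x)"
  by (induction k) (simp_all add: assms)

section \<open>Parameter derivatives of semiconjugate families\<close>

text \<open>Subtracting \<open>f\<^sub>t(x)\<close> from both sides of the differentiated identity leaves
  \<open>f\<^sub>x(x) G\<^sub>t(x) - H\<^sub>t(f(x)) = (f\<^sub>x(x) - f\<^sub>x(G(x))) G\<^sub>t(x) + (f\<^sub>t(x) - f\<^sub>t(G(x))) + (H\<^sub>x(f(x)) - 1) f\<^sub>t(x)\<close>
  at \<open>t = 0\<close>. The first two brackets are small because \<open>G\<close> is tangent to the identity at \<open>a\<close>, the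
  third one because \<open>H\<^sub>x - 1\<close> vanishes to order \<open>n\<close> at \<open>f(a)\<close>.\<close>

lemma semiconj_param_derivative:
  assumes U: "open U" "convex U" "0 \<in> U"
    and S: "convex S" "no_isolated_points S" and T: "convex T" "no_isolated_points T"
    and f: "fiber_map (Suc n) U S T f" and G: "fiber_map (Suc n) U S S G"
    and H: "fiber_map (Suc n) U T T H"
    and semi: "\<And>x t. x \<in> S \<Longrightarrow> t \<in> U \<Longrightarrow> f (G x t) t = H (f x t) t"
    and a: "a \<in> S" and AG: "A_conditions (Suc n) S G a 0" and AH: "A_conditions (Suc n) T H (f a 0) 0"
    and fx: "dx S 1 f a 0 \<noteq> 0"
  shows "(\<lambda>x. dx S 1 f x 0 * deriv (G x) 0 - deriv (H (f x 0)) 0)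
           \<in> o[at a within S](\<lambda>x. (x - a) ^ n)"
proof -
  let ?o = "o[at a within S](\<lambda>x. (x - a) ^ n)"
  have Cf: "C_family (Suc n) S U f" and fT: "\<And>x t. x \<in> S \<Longrightarrow> t \<in> U \<Longrightarrow> f x t \<in> T"
    and CG: "C_family (Suc n) S U G" and GS: "\<And>x t. x \<in> S \<Longrightarrow> t \<in> U \<Longrightarrow> G x t \<in> S"
    and CH: "C_family (Suc n) T U H"
    using f G H by (auto simp: fiber_map_def simp del: C_family.simps)
  note Pf = C_family_SucD[OF U(1) S(2) Cf]
  note PG = C_family_SucD[OF U(1) S(2) CG]
  note PH = C_family_SucD[OF U(1) T(2) CH]
  define fX where "fX = (\<lambda>x. dx S 1 f x 0)"
  define HX where "HX = (\<lambda>y. dx T 1 H y 0)"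
  define fL where "fL = (\<lambda>x. deriv (f x) 0)"
  define GL where "GL = (\<lambda>x. deriv (G x) 0)"
  define HL where "HL = (\<lambda>y. deriv (H y) 0)"
  have diff_semi: "fX (G x 0) * GL x + fL (G x 0) = HX (f x 0) * fL x + HL (f x 0)" if x: "x \<in> S" for x
  proof -
    have "((\<lambda>t. f (G x t) t) has_real_derivative fX (G x 0) * GL x + fL (G x 0)) (at 0)"
      using has_partialsD(2)[OF has_partials_compose[OF U(1,2) PG(1) GS Pf(1,3)] x U(3)]
      by (simp add: fX_def GL_def fL_def)
    moreover have "((\<lambda>t. H (f x t) t) has_real_derivative HX (f x 0) * fL x + HL (f x 0)) (at 0)"
      using has_partialsD(2)[OF has_partials_compose[OF U(1,2) Pf(1) fT PH(1,3)] x U(3)]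
      by (simp add: HX_def HL_def fL_def)
    then have "((\<lambda>t. f (G x t) t) has_real_derivative HX (f x 0) * fL x + HL (f x 0)) (at 0)"
      by (rule has_field_derivative_transform_within_open[OF _ U(1,3)]) (simp add: semi x)
    ultimately show ?thesis by (rule DERIV_unique)
  qed
  have contG: "continuous_on S (\<lambda>x. G x 0)"
    using jet_onD(2)[OF jet_on_dx[OF U(1,2) S(2) CG U(3)], of 0] by simp
  have Ga: "G a 0 = a" using AG by (simp add: A_conditions_def)
  have G_id: "(\<lambda>x. G x 0 - x) \<in> ?o"
  proof -
    \<comment> \<open>the jet of \<open>G(x) - x\<close>, with \<open>x\<close> written as \<open>(x - a) + a\<close>\<close>
    let ?w = "\<lambda>i x. dx S i G x 0 - (if i \<le> 1 then 1 * (x - a) ^ (1 - i) / fact (1 - i) else 0)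
                     - (if i \<le> 0 then a * (x - a) ^ (0 - i) / fact (0 - i) else 0)"
    have "?w 0 \<in> ?o"
    proof (rule smallo_if_jet_zero[where w = ?w])
      show "jet_on S n ?w"
        by (intro jet_on_diff jet_on_power jet_on_mono[OF jet_on_dx[OF U(1,2) S(2) CG U(3)]]) simp
      show "?w i a = 0" if "i \<le> n" for i
      proof -
        consider "i = 0" | "i = 1" | "2 \<le> i" by linarith
        then show ?thesis
          using AG that by cases (auto simp: A_conditions_def)
      qed
    qed (use S a in auto)
    then show ?thesis by (simp add: algebra_simps)
  qed
  have "jet_on S n (\<lambda>i x. dx S i (dx S 1 f) x 0)" by (rule jet_on_dx[OF U(1,2) S(2) Pf(2) U(3)])
  from smallo_compose_near_identity[OF this S(1) a GS[OF _ U(3)] contG Ga G_id]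
  have fX: "(\<lambda>x. fX x - fX (G x 0)) \<in> ?o" by (simp add: fX_def)
  from smallo_compose_near_identity[OF jet_on_param_derivative[OF U(1,2) S Cf U(3)]
      S(1) a GS[OF _ U(3)] contG Ga G_id]
  have fL: "(\<lambda>x. fL x - fL (G x 0)) \<in> ?o" by (simp add: fL_def)
  have f_deriv: "((\<lambda>x. f x 0) has_real_derivative fX a) (at a within S)"
    using has_partialsD(1)[OF Pf(1) a U(3)] by (simp add: fX_def)
  have HX: "(\<lambda>x. HX (f x 0) - 1) \<in> ?o"
  proof -
    \<comment> \<open>the jet of \<open>H\<^sub>x(y) - 1\<close>\<close>
    let ?w = "\<lambda>i y. dx T i (dx T 1 H) y 0
                     - (if i \<le> 0 then 1 * (y - f a 0) ^ (0 - i) / fact (0 - i) else 0)"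
    have "?w 0 \<in> o[at (f a 0) within T](\<lambda>y. (y - f a 0) ^ n)"
    proof (rule smallo_if_jet_zero[where w = ?w])
      show "jet_on T n ?w"
        by (intro jet_on_diff jet_on_power jet_on_dx[OF U(1,2) T(2) PH(2) U(3)])
      show "?w i (f a 0) = 0" if "i \<le> n" for i
        using AH that unfolding dx_dx_1 by (cases "i = 0") (auto simp: A_conditions_def)
    qed (use T fT a U in auto)
    then have "(\<lambda>y. HX y - 1) \<in> o[at (f a 0) within T](\<lambda>y. (y - f a 0) ^ n)"
      by (simp add: HX_def)
    then have "(\<lambda>x. HX (f x 0) - 1) \<in> o[at a within S](\<lambda>x. (f x 0 - f a 0) ^ n)"
      by (rule landau_o.small.compose)
         (rule filterlim_at_within_if_derivative_nonzero[OF f_deriv], use fx fT U in \<open>auto simp: fX_def\<close>)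
    moreover have "(\<lambda>x. (f x 0 - f a 0) ^ n) \<in> \<Theta>[at a within S](\<lambda>x. (x - a) ^ n)"
      using bigtheta_power_if_derivative_nonzero[OF f_deriv] fx by (simp add: fX_def)
    ultimately show ?thesis by (metis landau_o.small.cong_bigtheta)
  qed
  have bounded: "g \<in> O[at a within S](\<lambda>_. 1)" if "continuous_on S g" for g :: "real \<Rightarrow> real"
    using that a by (intro bigoI_tendsto[where c = "g a"]) (auto simp: continuous_on_def)
  have "continuous_on S GL" "continuous_on S fL"
    using jet_onD(2)[OF jet_on_param_derivative[OF U(1,2) S CG U(3)], of 0]
      jet_onD(2)[OF jet_on_param_derivative[OF U(1,2) S Cf U(3)], of 0]
    by (simp_all add: GL_def fL_def)
  then have "(\<lambda>x. (fX x - fX (G x 0)) * GL x + (fL x - fL (G x 0)) + (HX (f x 0) - 1) * fL x) \<in> ?o"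
    using landau_o.small_big_mult[OF fX bounded] landau_o.small_big_mult[OF HX bounded]
    by (intro sum_in_smallo(1) fL) simp_all
  moreover have "\<forall>\<^sub>F x in at a within S.
      (fX x - fX (G x 0)) * GL x + (fL x - fL (G x 0)) + (HX (f x 0) - 1) * fL x = fX x * GL x - HL (f x 0)"
    unfolding eventually_at_filter
    by (rule always_eventually) (auto simp: algebra_simps dest!: diff_semi)
  ultimately have "(\<lambda>x. fX x * GL x - HL (f x 0)) \<in> ?o"
    by (subst (asm) landau_o.small.in_cong)
  then show ?thesis by (simp add: fX_def GL_def HL_def)
qed

section \<open>The Jacobian determinant\<close>

text \<open>A square matrix is singular iff it has a nonzero kernel vector. Through \<open>num\<close> its rows run over the
  orders \<open>0, \<dots>, n\<close>.\<close>

lemma param_jacobian_eq_0_iff: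
  fixes num :: "'n::finite \<Rightarrow> nat"
  assumes "bij_betw num UNIV {1..Suc n}"
  shows "param_jacobian num S H x \<Lambda> = 0 \<longleftrightarrow>
    (\<exists>v :: real ^ 'n. v \<noteq> 0 \<and> (\<forall>i\<le>n. (\<Sum>r\<in>UNIV. v $ r * dparam r (dx S i H) x \<Lambda>) = 0))"
proof -
  define A :: "real ^ 'n ^ 'n" where "A = (\<chi> s r. dparam r (dx S (num s - 1) H) x \<Lambda>)"
  have rows: "(\<forall>s. P (num s - 1)) \<longleftrightarrow> (\<forall>i\<le>n. P i)" for P
  proof
    assume P: "\<forall>s. P (num s - 1)"
    show "\<forall>i\<le>n. P i"
    proof (intro allI impI)
      fix i assume "i \<le> n"
      then have "Suc i \<in> num ` UNIV" using assms by (auto simp: bij_betw_def)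
      then obtain s where "num s = Suc i" by force
      with P show "P i" by (metis diff_Suc_1)
    qed
  next
    assume "\<forall>i\<le>n. P i"
    moreover have "num s - 1 \<le> n" for s
      using bij_betwE[OF assms, THEN bspec, of s] by auto
    ultimately show "\<forall>s. P (num s - 1)" by blast
  qed
  have kernel: "A *v v = 0 \<longleftrightarrow> (\<forall>i\<le>n. (\<Sum>r\<in>UNIV. v $ r * dparam r (dx S i H) x \<Lambda>) = 0)" for v
    unfolding rows[symmetric]
    by (simp add: vec_eq_iff matrix_vector_mult_def A_def mult.commute)
  have "param_jacobian num S H x \<Lambda> = 0 \<longleftrightarrow> \<not> invertible A"
    by (simp add: param_jacobian_def A_def invertible_det_nz)
  also have "\<dots> \<longleftrightarrow> (\<exists>v. v \<noteq> 0 \<and> A *v v = 0)"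
    by (auto simp: invertible_left_inverse matrix_left_invertible_ker)
  finally show ?thesis by (simp only: kernel)
qed

text \<open>The restriction of a family to the line through \<open>\<Lambda>\<close> in direction \<open>r\<close>. At \<open>\<Lambda>\<close>, neither \<open>dx\<close> nor
  \<open>dparam r\<close> sees more of the parameter space, and composition of maps commutes with the restriction.\<close>

definition along :: "real ^ 'n \<Rightarrow> 'n::finite \<Rightarrow> (real \<Rightarrow> real ^ 'n \<Rightarrow> real) \<Rightarrow> real \<Rightarrow> real \<Rightarrow> real" where
  "along \<Lambda> r h x t = h x (\<Lambda> + t *\<^sub>R axis r 1)"

lemma dx_along: "dx S i (along \<Lambda> r h) = along \<Lambda> r (dx S i h)"
  by (simp add: dx_def along_def fun_eq_iff)

lemma dparam_eq_deriv_along: "dparam r h x \<Lambda> = deriv (along \<Lambda> r h x) 0"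
  by (simp add: dparam_def along_def[abs_def])

lemma A_conditions_along: "A_conditions \<mu> S (along \<Lambda> r h) a 0 \<longleftrightarrow> A_conditions \<mu> S h a \<Lambda>"
  by (simp add: A_conditions_def dx_along) (simp add: along_def)

lemma iter_x_along: "iter_x k (along \<Lambda> r F) = along \<Lambda> r (iter_x k F)"
  by (simp add: iter_x_def along_def fun_eq_iff)

lemma C_family_along:
  assumes reg: "regular_family (Suc n) S \<Theta> h" and U: "\<And>t. t \<in> U \<Longrightarrow> \<Lambda> + t *\<^sub>R axis r 1 \<in> \<Theta>"
  shows "C_family (Suc n) S U (along \<Lambda> r h)"
proof (rule C_family_if_iterated_partials)
  let ?l = "\<lambda>t. \<Lambda> + t *\<^sub>R axis r 1"
  have C1: "C1_joint S \<Theta> (dx S i h)" if "i < Suc n" for i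
    using reg that by (simp add: regular_family_def)
  have cont: "continuous_on (S \<times> U) (\<lambda>(x, t). along \<Lambda> r g x t)"
    if "continuous_on (S \<times> \<Theta>) (\<lambda>(x, \<Lambda>). g x \<Lambda>)" for g
  proof -
    have "continuous_on (S \<times> U) (\<lambda>(x, t). (\<lambda>(x, \<Lambda>). g x \<Lambda>) (x, ?l t))"
      unfolding case_prod_unfold
      by (rule continuous_on_compose2[OF that[unfolded case_prod_unfold]])
         (use U in \<open>auto intro!: continuous_intros\<close>)
    then show ?thesis by (simp add: along_def)
  qed
  show "has_partials S U (dx S i (along \<Lambda> r h)) (dx S (Suc i) (along \<Lambda> r h))
          (along \<Lambda> r (dparam r (dx S i h)))" if i: "i < Suc n" for i
    unfolding has_partials_def dx_along
  proof (intro ballI conjI)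
    fix x t assume x: "x \<in> S" and t: "t \<in> U"
    have "(\<lambda>y. dx S i h y (?l t)) differentiable (at x within S)"
      using C1[OF i] x U[OF t] by (simp add: C1_joint_def)
    then show "((\<lambda>y. along \<Lambda> r (dx S i h) y t) has_real_derivative along \<Lambda> r (dx S (Suc i) h) x t)
                 (at x within S)"
      by (simp add: has_real_derivative_iff_has_vector_derivative vector_derivative_works
          along_def dx_def)
    have "(\<lambda>s. dx S i h x (?l t + s *\<^sub>R axis r 1)) field_differentiable (at 0)"
      using C1[OF i] x U[OF t] by (simp add: C1_joint_def)
    then have "((\<lambda>s. dx S i h x (?l t + s *\<^sub>R axis r 1)) has_real_derivative
                 dparam r (dx S i h) x (?l t)) (at 0)"
      by (simp add: DERIV_deriv_iff_field_differentiable dparam_def)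
    then show "(along \<Lambda> r (dx S i h) x has_real_derivative along \<Lambda> r (dparam r (dx S i h)) x t) (at t)"
      using DERIV_shift[of "along \<Lambda> r (dx S i h) x" _ 0 t]
      by (simp add: along_def algebra_simps)
  qed
  show "continuous_on (S \<times> U) (\<lambda>(x, t). along \<Lambda> r (dparam r (dx S i h)) x t)" if i: "i < Suc n" for i
    using C1[OF i] by (intro cont) (simp add: C1_joint_def)
  have "continuous_on (S \<times> \<Theta>) (\<lambda>(x, \<Lambda>). dx S 1 (dx S n h) x \<Lambda>)"
    using C1[of n] by (simp add: C1_joint_def)
  then have "continuous_on (S \<times> \<Theta>) (\<lambda>(x, \<Lambda>). dx S (Suc n) h x \<Lambda>)"
    by (simp add: dx_def)
  then show "continuous_on (S \<times> U) (\<lambda>(x, t). dx S (Suc n) (along \<Lambda> r h) x t)"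
    unfolding dx_along by (rule cont)
qed

text \<open>The asymptotic relation between \<open>G\<^sub>\<lambda>\<close> and \<open>H\<^sub>\<lambda> \<circ> f\<close> has the same factor \<open>f\<^sub>x\<close> for every parameter, so it
  passes to linear combinations. Hence a kernel vector of one matrix is one of the other.\<close>

lemma param_jacobian_zero_iff_semiconj:
  fixes num :: "'n::finite \<Rightarrow> nat" and \<Lambda> :: "real ^ 'n"
  assumes num: "bij_betw num UNIV {1..Suc n}"
    and U: "open U" "convex U" "0 \<in> U"
    and S: "convex S" "no_isolated_points S" and T: "convex T" "no_isolated_points T"
    and f: "\<And>r. fiber_map (Suc n) U S T (along \<Lambda> r f)"
    and G: "\<And>r. fiber_map (Suc n) U S S (along \<Lambda> r G)"
    and H: "\<And>r. fiber_map (Suc n) U T T (along \<Lambda> r H)"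
    and semi: "\<And>x \<Lambda>. f (G x \<Lambda>) \<Lambda> = H (f x \<Lambda>) \<Lambda>"
    and a: "a \<in> S" and AG: "A_conditions (Suc n) S G a \<Lambda>" and AH: "A_conditions (Suc n) T H (f a \<Lambda>) \<Lambda>"
    and fx: "dx S 1 f a \<Lambda> \<noteq> 0"
  shows "param_jacobian num S G a \<Lambda> = 0 \<longleftrightarrow> param_jacobian num T H (f a \<Lambda>) \<Lambda> = 0"
proof -
  have C: "C_family (Suc n) S U (along \<Lambda> r f)" "C_family (Suc n) S U (along \<Lambda> r G)"
    "C_family (Suc n) T U (along \<Lambda> r H)" for r
    using f G H by (simp_all add: fiber_map_def del: C_family.simps)
  have at0: "along \<Lambda> r h x 0 = h x \<Lambda>" for r x and h :: "real \<Rightarrow> real ^ 'n \<Rightarrow> real"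
    by (simp add: along_def)
  have fT: "f x \<Lambda> \<in> T" if "x \<in> S" for x
  proof -
    have "along \<Lambda> undefined f x 0 \<in> T" using f[of undefined] that U(3) unfolding fiber_map_def by blast
    then show ?thesis by (simp only: at0)
  qed
  have f_jet: "jet_on S (Suc n) (\<lambda>i x. dx S i f x \<Lambda>)"
    using jet_on_dx[OF U(1,2) S(2) C(1) U(3)] by (simp add: dx_along at0)
  have small: "(\<lambda>x. dx S 1 f x \<Lambda> * dparam r G x \<Lambda> - dparam r H (f x \<Lambda>) \<Lambda>)
                 \<in> o[at a within S](\<lambda>x. (x - a) ^ n)" for r
    using semiconj_param_derivative[OF U S T f[of r] G[of r] H[of r], of a] semi a AG AH fx
    by (simp add: A_conditions_along at0 dx_along dparam_eq_deriv_along) (simp add: along_def)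
  have "(\<forall>i\<le>n. (\<Sum>r\<in>UNIV. v $ r * dparam r (dx S i G) a \<Lambda>) = 0) \<longleftrightarrow>
        (\<forall>i\<le>n. (\<Sum>r\<in>UNIV. v $ r * dparam r (dx T i H) (f a \<Lambda>) \<Lambda>) = 0)" for v :: "real ^ 'n"
  proof (rule jets_vanish_iff_transport[where \<phi> = "\<lambda>x. f x \<Lambda>" and S = S and T = T
        and u = "\<lambda>i x. \<Sum>r\<in>UNIV. v $ r * dparam r (dx S i G) x \<Lambda>"
        and w = "\<lambda>i x. \<Sum>r\<in>UNIV. v $ r * dparam r (dx T i H) x \<Lambda>"])
    show "jet_on S n (\<lambda>i x. \<Sum>r\<in>UNIV. v $ r * dparam r (dx S i G) x \<Lambda>)"
      unfolding dparam_eq_deriv_along dx_along[symmetric]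
      by (intro jet_on_linear_combination jet_on_param_derivative[OF U(1,2) S C(2) U(3)])
    show "jet_on T n (\<lambda>i x. \<Sum>r\<in>UNIV. v $ r * dparam r (dx T i H) x \<Lambda>)"
      unfolding dparam_eq_deriv_along dx_along[symmetric]
      by (intro jet_on_linear_combination jet_on_param_derivative[OF U(1,2) T C(3) U(3)])
    show "((\<lambda>x. f x \<Lambda>) has_real_derivative dx S 1 f a \<Lambda>) (at a within S)"
      using jet_onD(1)[OF f_jet, of 0 a] a by simp
    show "((\<lambda>x. dx S 1 f x \<Lambda>) \<longlongrightarrow> dx S 1 f a \<Lambda>) (at a within S)"
      using jet_onD(2)[OF f_jet, of 1] a by (simp add: continuous_on_def)
    have "(\<lambda>x. v $ r * (dx S 1 f x \<Lambda> * dparam r G x \<Lambda> - dparam r H (f x \<Lambda>) \<Lambda>))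
            \<in> o[at a within S](\<lambda>x. (x - a) ^ n)" for r
      using small[of r] by (cases "v $ r = 0") simp_all
    then have "(\<lambda>x. \<Sum>r\<in>UNIV. v $ r * (dx S 1 f x \<Lambda> * dparam r G x \<Lambda> - dparam r H (f x \<Lambda>) \<Lambda>))
            \<in> o[at a within S](\<lambda>x. (x - a) ^ n)"
      by (rule big_sum_in_smallo)
    then show "(\<lambda>x. dx S 1 f x \<Lambda> * (\<Sum>r\<in>UNIV. v $ r * dparam r (dx S 0 G) x \<Lambda>)
                 - (\<Sum>r\<in>UNIV. v $ r * dparam r (dx T 0 H) (f x \<Lambda>) \<Lambda>))
            \<in> o[at a within S](\<lambda>x. (x - a) ^ n)"
      by (simp add: sum_distrib_left sum_subtractf right_diff_distrib mult_ac)
    show "at a within S \<noteq> bot" using S(2) a by (simp add: no_isolated_points_def)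
  qed (use S T a fx fT in auto)
  then show ?thesis unfolding param_jacobian_eq_0_iff[OF num] by simp
qed

theorem theorem3p7:
  fixes \<mu> p k j :: nat
    and I :: "nat \<Rightarrow> real set"
    and \<Theta> :: "(real ^ 'n::finite) set"
    and num :: "'n \<Rightarrow> nat"
    and f :: "nat \<Rightarrow> real \<Rightarrow> real ^ 'n \<Rightarrow> real"
    and a :: "nat \<Rightarrow> real"
    and \<Lambda>\<^sub>0 :: "real ^ 'n"
  assumes "\<mu> = CARD('n)" and "bij_betw num UNIV {1..\<mu>}"
    and "0 < p" and "0 < k"
    and "\<And>i. i < p \<Longrightarrow> is_interval (I i) \<and> interior (I i) \<noteq> {}"
    and "open \<Theta>"
    and "periodic_system p I \<Theta> f"
    and "\<And>i. i < p \<Longrightarrow> regular_family \<mu> (I i) \<Theta> (f i)"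
    and "\<Lambda>\<^sub>0 \<in> \<Theta>"
    and "a 0 \<in> I 0" and "\<And>m. m + 1 < p \<Longrightarrow> a (m + 1) = f m (a m) \<Lambda>\<^sub>0"
    and "\<And>m. m < p \<Longrightarrow> A_conditions \<mu> (I m) (iter_x k (cyclic_comp f p m)) (a m) \<Lambda>\<^sub>0"
    and "j < p"
    and "param_jacobian num (I j) (iter_x k (cyclic_comp f p j)) (a j) \<Lambda>\<^sub>0 \<noteq> 0"
  shows "\<forall>m<p. param_jacobian num (I m) (iter_x k (cyclic_comp f p m)) (a m) \<Lambda>\<^sub>0 \<noteq> 0"
proof -
  obtain n where \<mu>: "\<mu> = Suc n"
    using \<open>\<mu> = CARD('n)\<close> by (metis gr0_conv_Suc zero_less_card_finite)
  obtain \<delta> where "\<delta> > 0" and \<delta>: "ball \<Lambda>\<^sub>0 \<delta> \<subseteq> \<Theta>"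
    using \<open>open \<Theta>\<close> \<open>\<Lambda>\<^sub>0 \<in> \<Theta>\<close> openE by blast
  define U :: "real set" where "U = ball 0 \<delta>"
  have U: "open U" "convex U" "0 \<in> U" using \<open>\<delta> > 0\<close> by (simp_all add: U_def)
  have in_\<Theta>: "\<Lambda>\<^sub>0 + t *\<^sub>R axis r 1 \<in> \<Theta>" if "t \<in> U" for t and r :: 'n
    using that by (intro subsetD[OF \<delta>]) (simp add: U_def dist_norm norm_axis_1)
  have fiber: "convex (I i)" "no_isolated_points (I i)" if "i < p" for i
    using assms(5)[OF that] by (auto simp: is_interval_convex no_isolated_points_interval)
  have maps: "f i x \<Lambda> \<in> I ((i + 1) mod p)" if "i < p" "x \<in> I i" "\<Lambda> \<in> \<Theta>" for i x \<Lambda>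
    using \<open>periodic_system p I \<Theta> f\<close> that by (simp add: periodic_system_def)
  have f_along: "fiber_map (Suc n) U (I i) (I ((i + 1) mod p)) (along \<Lambda>\<^sub>0 r (f i))" if "i < p" for i r
    unfolding fiber_map_def
    using C_family_along[where r = r and U = U, OF assms(8)[OF that, unfolded \<mu>] in_\<Theta>] maps[OF that _ in_\<Theta>]
    by (simp add: along_def del: C_family.simps)
  have a: "m < p \<Longrightarrow> a m \<in> I m" for m
  proof (induction m)
    case (Suc m)
    then show ?case using maps[of m "a m" \<Lambda>\<^sub>0] assms(11)[of m] \<open>\<Lambda>\<^sub>0 \<in> \<Theta>\<close> by simp
  qed (use \<open>a 0 \<in> I 0\<close> in simp)
  define F where "F m = iter_x k (cyclic_comp f p m)" for m
  have wrap_along: "fiber_map (Suc n) U (I l) (I m)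
      (along \<Lambda>\<^sub>0 r (\<lambda>x \<Lambda>. fold (\<lambda>i y. f i y \<Lambda>) ([l..<p] @ [0..<m]) x))" if "l < p" "m < p" for l m r
    using fiber_map_fold_wrap[where f = "\<lambda>i. along \<Lambda>\<^sub>0 r (f i)", OF U(1,2) f_along that]
    by (simp add: along_def[abs_def])
  have cyclic_along: "fiber_map (Suc n) U (I m) (I m) (along \<Lambda>\<^sub>0 r (iter_x q (cyclic_comp f p m)))"
    if "m < p" for m q r
    using fiber_map_iter_x[OF U(1,2) wrap_along[OF that that, of r], of q]
    by (simp add: iter_x_along cyclic_comp_def[abs_def])
  have step: "param_jacobian num (I m) (F m) (a m) \<Lambda>\<^sub>0 = 0 \<longleftrightarrow>
      param_jacobian num (I (Suc m)) (F (Suc m)) (a (Suc m)) \<Lambda>\<^sub>0 = 0" if m: "Suc m < p" for m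
  proof -
    have m': "m < p" and a_Suc: "a (Suc m) = f m (a m) \<Lambda>\<^sub>0" and mod: "(m + 1) mod p = Suc m"
      using m assms(11)[of m] by simp_all
    \<comment> \<open>\<open>R\<close> applies all the maps but \<open>f\<^sub>m\<close>, so \<open>F\<^sub>m = R \<circ> f\<^sub>m\<close> and \<open>F\<^sub>m\<^sub>+\<^sub>1 = f\<^sub>m \<circ> R\<close>.\<close>
    define R where "R x \<Lambda> = fold (\<lambda>i y. f i y \<Lambda>) ([Suc m..<p] @ [0..<m]) x" for x \<Lambda>
    have cyc: "cyclic_comp f p m x \<Lambda> = R (f m x \<Lambda>) \<Lambda>"
      "cyclic_comp f p (Suc m) x \<Lambda> = f m (R x \<Lambda>) \<Lambda>" for x \<Lambda>
      using m by (simp_all add: cyclic_comp_def R_def upt_conv_Cons[of m p])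
    have semi: "f m (F m x \<Lambda>) \<Lambda> = F (Suc m) (f m x \<Lambda>) \<Lambda>" for x \<Lambda>
      unfolding F_def iter_x_def by (rule funpow_semiconj) (simp add: cyc)
    let ?g = "\<lambda>x \<Lambda>. iter_x (k - 1) (cyclic_comp f p m) (R x \<Lambda>) \<Lambda>"
    have factor: "F m x \<Lambda> = ?g (f m x \<Lambda>) \<Lambda>" for x \<Lambda>
      using \<open>0 < k\<close> by (cases k) (simp_all add: F_def iter_x_def funpow_Suc_right cyc del: funpow.simps)
    have f_m: "fiber_map (Suc n) U (I m) (I (Suc m)) (along \<Lambda>\<^sub>0 r (f m))" for r
      using f_along[OF m', of r] mod by simp
    have "dx (I m) 1 (f m) (a m) \<Lambda>\<^sub>0 \<noteq> 0"
    proof -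
      \<comment> \<open>The \<open>x\<close>-derivatives at \<open>\<Lambda>\<^sub>0\<close> can be read off along any one parameter line.\<close>
      fix r :: 'n
      have "fiber_map (Suc n) U (I (Suc m)) (I m) (along \<Lambda>\<^sub>0 r R)"
        using wrap_along[OF m m', of r] by (simp add: R_def[abs_def])
      from fiber_map_compose[OF U(1,2) this cyclic_along[OF m', of r "k - 1"]]
      have g: "C_family (Suc n) (I (Suc m)) U (along \<Lambda>\<^sub>0 r ?g)"
        by (simp add: fiber_map_def along_def[abs_def] del: C_family.simps)
      have "dx (I m) 1 (along \<Lambda>\<^sub>0 r (F m)) (a m) 0
          = dx (I (Suc m)) 1 (along \<Lambda>\<^sub>0 r ?g) (along \<Lambda>\<^sub>0 r (f m) (a m) 0) 0
            * dx (I m) 1 (along \<Lambda>\<^sub>0 r (f m)) (a m) 0"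
        using dx_1_compose[OF U(1,2) fiber(2)[OF m'] fiber(2)[OF m] f_m[of r] g a[OF m'] U(3)]
        by (simp add: along_def[abs_def] factor)
      moreover have "dx (I m) 1 (F m) (a m) \<Lambda>\<^sub>0 = 1"
        using assms(12)[OF m'] by (simp add: A_conditions_def F_def)
      ultimately show ?thesis unfolding dx_along by (auto simp: along_def)
    qed
    moreover have "fiber_map (Suc n) U (I m) (I m) (along \<Lambda>\<^sub>0 r (F m))"
      "fiber_map (Suc n) U (I (Suc m)) (I (Suc m)) (along \<Lambda>\<^sub>0 r (F (Suc m)))" for r
      unfolding F_def by (rule cyclic_along[OF m'], rule cyclic_along[OF m])
    moreover have "A_conditions (Suc n) (I m) (F m) (a m) \<Lambda>\<^sub>0"
      "A_conditions (Suc n) (I (Suc m)) (F (Suc m)) (f m (a m) \<Lambda>\<^sub>0) \<Lambda>\<^sub>0"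
      using assms(12)[OF m'] assms(12)[OF m] by (simp_all only: F_def \<mu> a_Suc)
    ultimately show ?thesis
      unfolding a_Suc
      by (intro param_jacobian_zero_iff_semiconj[where f = "f m" and G = "F m" and H = "F (Suc m)",
            OF assms(2)[unfolded \<mu>] U fiber[OF m'] fiber[OF m] f_m _ _ semi a[OF m']])
  qed
  have all: "m < p \<Longrightarrow> param_jacobian num (I m) (F m) (a m) \<Lambda>\<^sub>0 = 0 \<longleftrightarrow>
      param_jacobian num (I 0) (F 0) (a 0) \<Lambda>\<^sub>0 = 0" for m
  proof (induction m)
    case (Suc m)
    then show ?case using step[of m] Suc_lessD by blast
  qed (rule refl)
  show ?thesis
    using all[OF \<open>j < p\<close>] all assms(14) unfolding F_def by blast
qed

end
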